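(* Let $l \ge 3$ and $k \ge 1$ be integers, and define \[ f(l,k) = \begin{cases} 6kl + 10k\log_2 k + 40k + 10k\log_2\log_2 k & \text{if } k \ge 2,\\ 0 & \text{if } k = 1.\end{cases} \] Then every finite graph $G$ either contains $k$ pairwise vertex-disjoint cycles each of length at least $l$, or contains a set $X \subseteq V(G)$ with $|X| \le f(l,k)$ such that the graph $G - X$ contains no cycle of length at least $l$.
   Context: Graphs are finite and simple. $G - X$ denotes the graph obtained from $G$ by deleting the vertices in $X$ (and all incident edges). The length of a cycle is its number of edges (equivalently, vertices). *)

theory Defs
  imports Complex_Main
begin

definition finite_simple_graph :: "'a set \<Rightarrow> ('a \<Rightarrow> 'a \<Rightarrow> bool) \<Rightarrow> bool" where
  "finite_simple_graph V E \<longleftrightarrow> finite V \<and> (\<forall>x y. E x y \<longrightarrow> x \<in> V \<and> y \<in> V)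
     \<and> (\<forall>x y. E x y \<longrightarrow> E y x) \<and> (\<forall>x. \<not> E x x)"

definition is_cycle :: "'a set \<Rightarrow> ('a \<Rightarrow> 'a \<Rightarrow> bool) \<Rightarrow> 'a list \<Rightarrow> bool" where
  "is_cycle V E c \<longleftrightarrow> 3 \<le> length c \<and> distinct c \<and> set c \<subseteq> V
     \<and> (\<forall>i < length c. E (c ! i) (c ! ((i + 1) mod length c)))"

definition del_verts_V :: "'a set \<Rightarrow> 'a set \<Rightarrow> 'a set" where
  "del_verts_V V X = V - X"

definition del_verts_E :: "('a \<Rightarrow> 'a \<Rightarrow> bool) \<Rightarrow> 'a set \<Rightarrow> 'a \<Rightarrow> 'a \<Rightarrow> bool" where
  "del_verts_E E X = (\<lambda>x y. E x y \<and> x \<notin> X \<and> y \<notin> X)"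

definition f_bound :: "nat \<Rightarrow> nat \<Rightarrow> real" where
  "f_bound l k = (if k \<ge> 2 then 6 * real k * real l + 10 * real k * log 2 (real k) + 40 * real k
                     + 10 * real k * log 2 (log 2 (real k)) else 0)"

end

theory Submission
  imports Defs
begin

text \<open>By induction on \<open>k\<close>: if some long cycle has at most \<open>6 * l\<close> vertices, delete it and apply the
  induction hypothesis. Otherwise cycles are either short (fewer than \<open>l\<close> vertices) or have more than
  \<open>6 * l\<close> vertices. Because of this gap, lying on a common short cycle is an equivalence
  relation \<open>eqv\<close> on edges, and no long cycle lies within one class.

  Let \<open>H\<close> be a subgraph with all degrees two or three and without short cycles, having as many
  edges as possible. If it has many branch vertices (vertices of degree three), it contains \<open>k\<close>
  disjoint cycles, as in Simonovits's proof of the Erdos-Posa theorem. By maximality, an \<open>H\<close>-path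
  joining vertices of degree two closes up to a short cycle with a path in \<open>H\<close>, so its edges are
  equivalent to those of that path. Delete the branch vertices, the vertices of \<open>H\<close> that are the
  only vertex of \<open>H\<close> on some long cycle (these cycles are disjoint), and, for every component of
  \<open>H\<close> minus the branch vertices, one vertex whose two edges in \<open>H\<close> are inequivalent (if there is
  one). A remaining long cycle has to change its class at such a vertex, and then it has to run
  through all such vertices of the component, one of which has been deleted.\<close>

subsection \<open>Walks, cycles and their edges\<close>

text \<open>The obstacle is that a long cycle may accompany \<open>H\<close> by means of ears, each
  of which closes a short cycle and therefore cannot be added to \<open>H\<close>; such a cycle
  leaves no trace as a long cycle of \<open>H\<close>. The relation \<open>eqv\<close> still locates
  it, because an ear and the path of \<open>H\<close> that it replaces have the same class, whereas
  a long cycle never fits into one class. Maximality only controls ears whose ends have degree two,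
  hence the deletion of the branch vertices, and it yields no ear for a cycle with a single vertex
  in \<open>H\<close>, hence the separate treatment of these vertices.

  With b branch vertices there are at most 3b/2 components attached to branch vertices, fewer than k
  components that contain a cycle of their own, and fewer than k of the single vertices, so at most
  5b/2 + 2(k-1) vertices are deleted. The logarithms enter through b \<le> 4r(k-1) + 1 for every r
  \<ge> 1 with b < 2^r; for k \<ge> 3, solving this for b gives b \<le> 4k(log k + log log k + 11/2)
  with logarithms to base 2. The summand 6kl pays for the short-enough long cycles deleted in the
  induction.\<close>

fun edges :: "'a list \<Rightarrow> 'a set set" where
  "edges (x # y # r) = insert {x, y} (edges (y # r))"
| "edges _ = {}"

text \<open>Repeating the head turns a cycle into a walk, so that every fact about
  \<open>edges\<close> also serves for cycles.\<close>

definition cedges :: "'a list \<Rightarrow> 'a set set" where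
  "cedges c = edges (c @ [hd c])"

text \<open>A graph is a bare set of edges with vertex set \<open>\<Union>F\<close>; subgraphs,
  unions with an ear and degrees are then plain set operations.\<close>

definition cyc :: "'a set set \<Rightarrow> 'a list \<Rightarrow> bool" where
  "cyc F c \<longleftrightarrow> 3 \<le> length c \<and> distinct c \<and> cedges c \<subseteq> F"

definition deg :: "'a set set \<Rightarrow> 'a \<Rightarrow> nat" where
  "deg F v = card {e \<in> F. v \<in> e}"

lemma edges_Cons: "edges (x # p) = (if p = [] then {} else insert {x, hd p} (edges p))"
  by (cases p) auto

lemma edges_append:
  "xs \<noteq> [] \<Longrightarrow> ys \<noteq> [] \<Longrightarrow>
    edges (xs @ ys) = insert {last xs, hd ys} (edges xs \<union> edges ys)"
  by (induction xs) (auto simp: edges_Cons)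

lemma edges_append_mid: "edges (xs @ y # ys) = edges (xs @ [y]) \<union> edges (y # ys)"
  by (induction xs) (auto simp: edges_Cons hd_append)

lemma edges_rev [simp]: "edges (rev p) = edges p"
  by (induction p) (auto simp: edges_Cons edges_append last_rev insert_commute)

lemma edges_rev_path: "edges (y # rev a @ [x]) = edges (x # a @ [y])"
  using edges_rev[of "x # a @ [y]"] by simp

lemma edges_subset: "e \<in> edges p \<Longrightarrow> e \<subseteq> set p"
  by (induction p rule: edges.induct) auto

lemma Union_edges: "2 \<le> length p \<Longrightarrow> \<Union>(edges p) = set p"
proof (induction p rule: edges.induct)
  case (1 x y r)
  then show ?case by (cases r) auto
qed auto

lemma finite_edges [simp]: "finite (edges p)"
  by (induction p rule: edges.induct) auto

lemma finite_cedges [simp]: "finite (cedges c)"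
  by (simp add: cedges_def)

lemma Union_cedges: "c \<noteq> [] \<Longrightarrow> \<Union>(cedges c) = set c"
  unfolding cedges_def by (subst Union_edges) (auto simp: Suc_le_eq)

lemma edges_not_hd: "distinct (x # p) \<Longrightarrow> e \<in> edges p \<Longrightarrow> x \<notin> e"
  using edges_subset by fastforce

lemma edges_conv_nth: "edges p = {{p ! i, p ! Suc i} | i. Suc i < length p}"
proof (induction p rule: edges.induct)
  case (1 x y r)
  have "{{(x # y # r) ! i, (x # y # r) ! Suc i} | i. Suc i < length (x # y # r)}
      = insert {x, y} {{(y # r) ! i, (y # r) ! Suc i} | i. Suc i < length (y # r)}"
    (is "?L = ?R")
  proof
    show "?L \<subseteq> ?R"
    proof
      fix e assume "e \<in> ?L"
      then obtain i where i: "e = {(x # y # r) ! i, (x # y # r) ! Suc i}"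
        "Suc i < length (x # y # r)" by blast
      then show "e \<in> ?R" by (cases i) auto
    qed
    show "?R \<subseteq> ?L"
    proof
      fix e assume "e \<in> ?R"
      then consider "e = {x, y}" |
        i where "e = {(y # r) ! i, (y # r) ! Suc i}" "Suc i < length (y # r)" by blast
      then show "e \<in> ?L"
      proof cases
        case 1
        then show ?thesis by (intro CollectI exI[of _ 0]) simp
      next
        case 2
        then show ?thesis by (intro CollectI exI[of _ "Suc i"]) simp
      qed
    qed
  qed
  then show ?case using 1 by simp
qed auto

lemma cyc_mono: "cyc F c \<Longrightarrow> F \<subseteq> F' \<Longrightarrow> cyc F' c"
  by (auto simp: cyc_def)

lemma cedges_rotate: "cedges (a @ b) = cedges (b @ a)"
proof (cases "a = [] \<or> b = []")
  case False
  then obtain x a' y b' where "a = x # a'" "b = y # b'" by (auto simp: neq_Nil_conv)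
  then show ?thesis
    using edges_append_mid[of a y "b' @ [x]"] edges_append_mid[of b x "a' @ [y]"]
    by (auto simp: cedges_def)
qed auto

lemma cyc_rotate: "cyc F (a @ b) \<Longrightarrow> cyc F (b @ a)"
  by (auto simp: cyc_def cedges_rotate[of b a])

lemma cedges_split: "cedges (x # a @ y # b) = edges (x # a @ [y]) \<union> edges (y # b @ [x])"
  using edges_append_mid[of "x # a" y "b @ [x]"] by (simp add: cedges_def)

lemma cycle_start:
  assumes "cyc F c" "x \<in> set c"
  obtains a where "cyc F (x # a)" "set (x # a) = set c" "length (x # a) = length c"
    "cedges (x # a) = cedges c"
proof -
  obtain p q where c: "c = p @ x # q" using assms(2) by (meson split_list)
  show ?thesis
    by (rule that[of "q @ p"])
      (use assms(1) c cyc_rotate[of F p "x # q"] cedges_rotate[of p "x # q"] in auto)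
qed

lemma cycle_split:
  assumes "cyc F c" "x \<in> set c" "y \<in> set c" "x \<noteq> y"
  obtains a b where "distinct (x # a @ y # b)" "set c = set (x # a @ y # b)"
    "length c = length a + length b + 2"
    "cedges c = edges (x # a @ [y]) \<union> edges (y # b @ [x])"
proof -
  obtain p where p: "cyc F (x # p)" "set (x # p) = set c" "length (x # p) = length c"
    "cedges (x # p) = cedges c" using cycle_start[OF assms(1,2)] .
  then have "y \<in> set p" using assms by auto
  then obtain a b where ab: "p = a @ y # b" by (meson split_list)
  show ?thesis
    by (rule that[of a b]) (use p ab cedges_split[of x a y b] in \<open>auto simp: cyc_def\<close>)
qed

lemma cyc_glue:
  assumes "distinct (x # a @ y # b)" "edges (x # a @ [y]) \<subseteq> F" "edges (y # b @ [x]) \<subseteq> F"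
    "a \<noteq> [] \<or> b \<noteq> []"
  shows "cyc F (x # a @ y # b)"
  unfolding cyc_def cedges_split using assms by (cases a; cases b) auto

lemma cycle_edge_start:
  assumes "cyc F c" "g \<in> cedges c"
  obtains s m t where "cyc F (s # m @ [t])" "g = {t, s}" "set (s # m @ [t]) = set c"
    "length (s # m @ [t]) = length c" "cedges (s # m @ [t]) = cedges c"
proof -
  obtain i where i: "g = {(c @ [hd c]) ! i, (c @ [hd c]) ! Suc i}" "Suc i < length (c @ [hd c])"
    using assms(2) unfolding cedges_def edges_conv_nth by blast
  define d where "d = drop (Suc i) c @ take (Suc i) c"
  have len: "3 \<le> length c" using assms(1) by (simp add: cyc_def)
  have "set d = set (take (Suc i) c @ drop (Suc i) c)"
    unfolding d_def set_append by blast
  then have d: "cyc F d" "cedges d = cedges c" "set d = set c" "length d = length c"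
    using assms(1) cyc_rotate[of F "take (Suc i) c" "drop (Suc i) c"]
      cedges_rotate[of "take (Suc i) c" "drop (Suc i) c"] len i
    unfolding d_def by (auto simp del: set_append)
  have "last d = c ! i"
    using i len by (simp add: d_def last_append take_Suc_conv_app_nth)
  moreover have "hd d = (c @ [hd c]) ! Suc i"
  proof (cases "Suc i < length c")
    case True
    then show ?thesis by (simp add: d_def hd_append hd_drop_conv_nth nth_append)
  next
    case False
    then have "Suc i = length c" using i by simp
    then show ?thesis by (simp add: d_def nth_append)
  qed
  ultimately have g: "g = {last d, hd d}" using i by (simp add: nth_append)
  have "3 \<le> length d" using d len by simp
  then obtain s d' where "d = s # d'" "d' \<noteq> []" by (auto simp: numeral_eq_Suc Suc_le_length_iff)
  then obtain m t where smt: "d = s # m @ [t]" by (metis rev_exhaust)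
  show ?thesis
    by (rule that[of s m t]) (use g d smt in auto)
qed

text \<open>Open the cycle at \<open>g\<close>. The first and the last vertex of \<open>S\<close> on
  the resulting list are the two ends of the stretch around \<open>g\<close> that avoids
  \<open>S\<close>. With \<open>S\<close> the vertex set of a subgraph, this stretch is an ear of
  that subgraph.\<close>

lemma ear_through:
  assumes c: "cyc F c" "g \<in> cedges c" and uv: "u \<in> set c" "v \<in> set c" "u \<noteq> v" "u \<in> S" "v \<in> S"
  obtains x y Q B where "x \<in> S" "y \<in> S" "set Q \<inter> S = {}" "distinct (x # Q @ y # B)"
    "g \<in> edges (x # Q @ [y])" "cedges c = edges (x # Q @ [y]) \<union> edges (y # B @ [x])"
    "set c = set (x # Q @ y # B)" "length c = length Q + length B + 2"
proof -
  obtain s m t where d: "cyc F (s # m @ [t])" "g = {t, s}" "set (s # m @ [t]) = set c"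
    "length (s # m @ [t]) = length c" "cedges (s # m @ [t]) = cedges c"
    using cycle_edge_start[OF c] .
  define d where "d = s # m @ [t]"
  have dd: "distinct d" using d(1) by (simp add: d_def cyc_def)
  have "\<exists>z\<in>set d. z \<in> S" using uv d by (auto simp: d_def)
  then obtain A x r where A: "d = A @ x # r" "x \<in> S" "\<forall>z\<in>set A. z \<notin> S"
    using split_list_first_prop[of d "\<lambda>z. z \<in> S"] by blast
  have "u \<in> set d" "v \<in> set d" using uv d by (auto simp: d_def)
  then have "\<exists>z\<in>set r. z \<in> S"
    using uv A by auto
  then obtain B y D where B: "r = B @ y # D" "y \<in> S" "\<forall>z\<in>set D. z \<notin> S"
    using split_list_last_prop[of r "\<lambda>z. z \<in> S"] by blast
  have eq: "d = (A @ x # B) @ (y # D)" using A B by simp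
  have ce: "cedges c = cedges (y # (D @ A) @ x # B)"
    using d(5) eq cedges_rotate[of "A @ x # B" "y # D"] by (simp add: d_def)
  have "g \<in> edges (y # (D @ A) @ [x])"
  proof -
    have "last (y # D) = t" "hd (A @ [x]) = s"
      using eq by (auto simp: d_def) (metis append_is_Nil_conv last.simps last_appendR last_snoc list.distinct(1), metis hd_append list.sel(1) append_Cons)
    then show ?thesis
      using edges_append[of "y # D" "A @ [x]"] d(2) by simp
  qed
  then show ?thesis
    by (intro that[of y x "D @ A" B])
      (use A B eq dd ce d cedges_split[of y "D @ A" x B] in \<open>auto simp: d_def[symmetric]\<close>)
qed

text \<open>Cuts a path with both ends in \<open>S\<close> at all its visits to \<open>S\<close>. It
  is used with the vertices of a cycle, with the vertices of \<open>H\<close>, and with the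
  switching vertices in the role of \<open>S\<close>.\<close>

lemma path_induct [consumes 3, case_names single step]:
  assumes "q \<noteq> []" "hd q \<in> S" "last q \<in> S"
    and "\<And>x. x \<in> S \<Longrightarrow> P [x]"
    and "\<And>x N v r. x \<in> S \<Longrightarrow> v \<in> S \<Longrightarrow> set N \<inter> S = {} \<Longrightarrow> P (v # r) \<Longrightarrow> P (x # N @ v # r)"
  shows "P q"
  using assms(1-3)
proof (induction "length q" arbitrary: q rule: less_induct)
  case less
  then obtain x t where q: "q = x # t" by (cases q) auto
  show ?case
  proof (cases "t = []")
    case True
    then show ?thesis using q assms(4) less.prems by simp
  next
    case False
    then have "\<exists>z\<in>set t. z \<in> S" using less.prems q by (auto intro!: bexI[of _ "last t"])
    then obtain N v r where t: "t = N @ v # r" "v \<in> S" "\<forall>z\<in>set N. z \<notin> S"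
      using split_list_first_prop[of t "\<lambda>z. z \<in> S"] by blast
    have "P (v # r)"
      by (rule less.hyps) (use less.prems q t in auto)
    then show ?thesis using assms(5)[of x v N r] t q less.prems by auto
  qed
qed

text \<open>The vertex \<open>u\<close> is the first one at which the walk passes from
  \<open>D\<close> to an edge outside \<open>D\<close>; with \<open>D\<close> a class of edges, this
  finds the vertices where a cycle changes its class.\<close>

lemma leave_class:
  "{a, b} \<in> D \<Longrightarrow> \<not> edges (a # b # r) \<subseteq> D \<Longrightarrow>
    \<exists>q u t r'. a # b # r = q @ u # t # r' \<and> q \<noteq> [] \<and> edges (q @ [u]) \<subseteq> D \<and>
      {last q, u} \<in> D \<and> {u, t} \<notin> D"
proof (induction r arbitrary: a b)
  case Nil
  then show ?case by simp
next
  case (Cons z r)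
  show ?case
  proof (cases "{b, z} \<in> D")
    case True
    then obtain q u t r' where *: "b # z # r = q @ u # t # r'" "q \<noteq> []" "edges (q @ [u]) \<subseteq> D"
      "{last q, u} \<in> D" "{u, t} \<notin> D"
      using Cons.IH[of b z] Cons.prems by auto
    have "hd (q @ [u]) = b" using * by (cases q) auto
    then have "edges ((a # q) @ [u]) \<subseteq> D"
      using * Cons.prems by (simp add: edges_Cons)
    moreover have "last (a # q) = last q" using * by simp
    ultimately show ?thesis using *
      by (intro exI[of _ "a # q"] exI[of _ u] exI[of _ t] exI[of _ r']) simp
  next
    case False
    then show ?thesis using Cons.prems
      by (intro exI[of _ "[a]"] exI[of _ b] exI[of _ z] exI[of _ r]) simp
  qed
qed

section \<open>Degrees along paths and cycles, and cycles inside paths and cycles\<close>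

lemma path_edge_unique:
  assumes "distinct (x # p)" "p \<noteq> []"
  shows "{e \<in> edges (x # p). x \<in> e} = {{x, hd p}}"
  using assms edges_not_hd[OF assms(1)] by (auto simp: edges_Cons)

lemma path_edges_interior:
  assumes "distinct (A @ v # B)" "A \<noteq> []" "B \<noteq> []"
  shows "{e \<in> edges (A @ v # B). v \<in> e} = {{last A, v}, {v, hd B}}" "last A \<noteq> hd B"
proof -
  have "edges (A @ v # B) = insert {last A, v} (insert {v, hd B} (edges A \<union> edges B))"
    using assms by (auto simp: edges_append edges_Cons)
  moreover have "v \<notin> e" if "e \<in> edges A \<union> edges B" for e
    using that edges_subset assms by fastforce
  ultimately show "{e \<in> edges (A @ v # B). v \<in> e} = {{last A, v}, {v, hd B}}" by auto
  have "last A \<in> set A" "hd B \<in> set B" using assms by auto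
  then show "last A \<noteq> hd B" using assms(1) by (metis IntI distinct_append empty_iff list.set_intros(2))
qed

lemma deg_path_interior:
  assumes "distinct (x # Q @ [y])" "v \<in> set Q"
  shows "deg (edges (x # Q @ [y])) v = 2"
proof -
  obtain A B where Q: "Q = A @ v # B" using assms by (meson split_list)
  have eq: "x # Q @ [y] = (x # A) @ v # (B @ [y])" using Q by simp
  have d: "distinct ((x # A) @ v # (B @ [y]))" using assms Q by simp
  show ?thesis
    unfolding deg_def eq
    by (subst path_edges_interior(1)[OF d])
      (use path_edges_interior(2)[OF d] in \<open>auto simp: card_insert_if doubleton_eq_iff\<close>)
qed

lemma deg_cycle:
  assumes "cyc F c" "v \<in> set c"
  shows "deg (cedges c) v = 2"
proof -
  obtain a where a: "cyc F (v # a)" "cedges (v # a) = cedges c"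
    using cycle_start[OF assms] by metis
  then have l: "2 \<le> length a" and d: "distinct (v # a)" by (auto simp: cyc_def)
  then have ne: "a \<noteq> []" by auto
  then obtain z a' where "a = z # a'" "a' \<noteq> []"
    using l by (cases a; cases "tl a") auto
  then have hl: "hd a \<noteq> last a" using d by auto
  have "cedges (v # a) = insert {v, hd a} (insert {last a, v} (edges a))"
    using ne by (auto simp: cedges_def edges_Cons edges_append)
  then have "{e \<in> cedges c. v \<in> e} = {{v, hd a}, {last a, v}}"
    using edges_not_hd[OF d] a by auto
  then show ?thesis using hl by (auto simp: deg_def card_insert_if doubleton_eq_iff)
qed

lemma deg_mono: "finite F' \<Longrightarrow> F \<subseteq> F' \<Longrightarrow> deg F v \<le> deg F' v"
  unfolding deg_def by (rule card_mono) auto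

lemma path_acyclic: "distinct p \<Longrightarrow> \<not> cyc (edges p) c"
proof (induction p arbitrary: c)
  case Nil
  show ?case
  proof
    assume c: "cyc (edges []) c"
    then have "c \<noteq> []" "cedges c = {}" by (auto simp: cyc_def)
    then show False using Union_cedges[of c] by simp
  qed
next
  case (Cons x p)
  show ?case
  proof
    assume c: "cyc (edges (x # p)) c"
    then have ne: "c \<noteq> []" by (auto simp: cyc_def)
    have "p \<noteq> []"
    proof
      assume "p = []"
      then have "cedges c = {}" using c by (auto simp: cyc_def)
      then show False using Union_cedges[OF ne] ne by simp
    qed
    have "x \<notin> set c"
    proof
      assume "x \<in> set c"
      then have "2 \<le> deg (edges (x # p)) x"
        using deg_cycle[OF c] deg_mono[of "edges (x # p)" "cedges c" x] c by (auto simp: cyc_def)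
      moreover have "deg (edges (x # p)) x = 1"
        using path_edge_unique[OF Cons.prems \<open>p \<noteq> []\<close>] by (simp add: deg_def)
      ultimately show False by simp
    qed
    then have "{x, hd p} \<notin> cedges c" using Union_cedges[OF ne] by blast
    then have "cyc (edges p) c" using c \<open>p \<noteq> []\<close> by (auto simp: cyc_def edges_Cons)
    then show False using Cons by simp
  qed
qed

text \<open>Only one edge of the path is available at \<open>x\<close>, so both paths take the same
  first step; then induct.\<close>

lemma path_unique:
  assumes "distinct (x # a @ [y])" "distinct (x # b @ [y])" "edges (x # b @ [y]) \<subseteq> edges (x # a @ [y])"
  shows "b = a"
  using assms
proof (induction a arbitrary: x b)
  case Nil
  then have "{x, hd (b @ [y])} = {x, y}" by (auto simp: edges_Cons)
  then have "hd (b @ [y]) = y" by (auto simp: doubleton_eq_iff)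
  then show ?case using Nil(2) by (cases b) auto
next
  case (Cons z a)
  have "{x, hd (b @ [y])} \<in> edges (x # b @ [y])"
    by (simp add: edges_Cons)
  then have "{x, hd (b @ [y])} \<in> {e \<in> edges (x # (z # a) @ [y]). x \<in> e}"
    using Cons.prems(3) by blast
  then have "{x, hd (b @ [y])} = {x, z}"
    by (subst (asm) path_edge_unique) (use Cons.prems(1) in simp_all)
  then have hz: "hd (b @ [y]) = z" by (auto simp: doubleton_eq_iff)
  show ?case
  proof (cases b)
    case Nil
    then have "z = y" using hz by simp
    then show ?thesis using Cons.prems(1) by simp
  next
    case (Cons w b')
    then have b: "b = z # b'" using hz by simp
    have "edges (z # b' @ [y]) \<subseteq> edges (z # a @ [y])"
    proof
      fix e assume e: "e \<in> edges (z # b' @ [y])"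
      then have "e \<in> edges (x # (z # a) @ [y])" using Cons.prems(3) b by auto
      moreover have "x \<notin> e" using edges_not_hd[of x "z # b' @ [y]" e] e Cons.prems(2) b by simp
      ultimately show "e \<in> edges (z # a @ [y])" by auto
    qed
    then show ?thesis using Cons.IH[of z b'] Cons.prems(1,2) b by simp
  qed
qed

text \<open>If an edge \<open>g\<close> of \<open>c\<close> were missing from \<open>d\<close>, then
  \<open>d\<close> would live in the path that remains of \<open>c\<close> without
  \<open>g\<close>.\<close>

lemma cycle_in_cycle:
  assumes "cyc F c" "cyc F' d" "cedges d \<subseteq> cedges c"
  shows "cedges d = cedges c"
proof (rule ccontr)
  assume "cedges d \<noteq> cedges c"
  then obtain g where g: "g \<in> cedges c" "g \<notin> cedges d" using assms by blast
  obtain s m t where smt: "cyc F (s # m @ [t])" "g = {t, s}" "cedges (s # m @ [t]) = cedges c"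
    using cycle_edge_start[OF assms(1) g(1)] by metis
  have "cedges (s # m @ [t]) = insert g (edges (s # m @ [t]))"
    using edges_append[of "s # m @ [t]" "[s]"] smt by (simp add: cedges_def)
  then have "cedges d \<subseteq> edges (s # m @ [t])" using g assms smt by auto
  then have "cyc (edges (s # m @ [t])) d" using assms by (auto simp: cyc_def)
  moreover have "distinct (s # m @ [t])" using smt(1) by (simp add: cyc_def)
  ultimately show False using path_acyclic by blast
qed

lemma walk_disjoint_Un:
  assumes "edges p \<subseteq> A \<union> B" "\<Union>A \<inter> \<Union>B = {}" "2 \<le> length p"
  shows "edges p \<subseteq> A \<or> edges p \<subseteq> B"
  using assms
proof (induction p rule: edges.induct)
  case (1 x y r)
  show ?case
  proof (cases r)
    case Nil
    then show ?thesis using 1 by auto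
  next
    case (Cons z s)
    then have IH: "edges (y # r) \<subseteq> A \<or> edges (y # r) \<subseteq> B" using 1 by auto
    moreover have "{y, z} \<in> edges (y # r)" using Cons by simp
    ultimately show ?thesis using 1(2,3) by auto
  qed
qed auto

lemma card_cedges: "cyc F c \<Longrightarrow> card (cedges c) = length c"
proof -
  have *: "distinct p \<Longrightarrow> card (edges p) = length p - 1" for p :: "'a list"
  proof (induction p rule: edges.induct)
    case (1 x y r)
    have "{x, y} \<notin> edges (y # r)" using edges_not_hd[OF 1(2)] by auto
    then show ?case using 1 by (simp del: edges.simps add: edges.simps(1)[of x y r])
  qed auto
  assume c: "cyc F c"
  then obtain s m t where smt: "c = s # m @ [t]" "m \<noteq> []"
  proof -
    have len: "3 \<le> length c" using c by (simp add: cyc_def)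
    then obtain s c' where "c = s # c'" "c' \<noteq> []" by (auto simp: numeral_eq_Suc Suc_le_length_iff)
    then obtain m t where "c = s # m @ [t]" by (metis rev_exhaust)
    then show thesis using that[of s m t] len by (cases m) auto
  qed
  have d: "distinct c" using c by (simp add: cyc_def)
  have ce: "cedges c = insert {t, s} (edges c)"
    using edges_append[of c "[s]"] smt by (simp add: cedges_def)
  have "{t, s} \<notin> edges c"
  proof
    assume "{t, s} \<in> edges c"
    then have "edges (s # [] @ [t]) \<subseteq> edges (s # m @ [t])" using smt by (auto simp: insert_commute)
    then show False using path_unique[of s m t "[]"] d smt by auto
  qed
  then show ?thesis using ce *[OF d] smt by simp
qed

subsection \<open>Disjoint cycles in subcubic graphs\<close>

text \<open>A list, so that one more cycle is added by consing. The value \<open>l = 0\<close> gives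
  plain disjoint cycles, which is the form needed inside \<open>H\<close>, where all cycles are long
  anyway.\<close>

definition packing :: "'a set set \<Rightarrow> nat \<Rightarrow> nat \<Rightarrow> bool" where
  "packing F l k \<longleftrightarrow> (\<exists>Cs. length Cs = k \<and> (\<forall>c\<in>set Cs. cyc F c \<and> l \<le> length c) \<and>
     sorted_wrt (\<lambda>c d. set c \<inter> set d = {}) Cs)"

text \<open>Double counting of incidences, relative to \<open>S\<close> so that it also applies to
  the vertices of a cycle, of a component or to the branch vertices.\<close>

lemma handshake:
  assumes "finite F" "finite S"
  shows "(\<Sum>v\<in>S. deg F v) = (\<Sum>e\<in>F. card (e \<inter> S))"
proof -
  have "(\<Sum>v\<in>S. deg F v) = (\<Sum>v\<in>S. \<Sum>e\<in>F. if v \<in> e then 1 else 0)"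
    using assms by (intro sum.cong refl) (simp add: deg_def sum.If_cases Int_def)
  also have "\<dots> = (\<Sum>e\<in>F. \<Sum>v\<in>S. if v \<in> e then 1 else 0)" by (rule sum.swap)
  also have "\<dots> = (\<Sum>e\<in>F. card (e \<inter> S))"
    using assms by (intro sum.cong refl) (simp add: sum.If_cases Int_commute)
  finally show ?thesis .
qed

lemma deg_pos: "finite F \<Longrightarrow> v \<in> \<Union>F \<Longrightarrow> 0 < deg F v"
  unfolding deg_def by (auto simp: card_gt_0_iff)

lemma deg_0: "v \<notin> \<Union>F \<Longrightarrow> deg F v = 0"
  unfolding deg_def by (subst card_eq_0_iff) auto

lemma deg_neighbours:
  assumes "\<forall>e\<in>F. card e = 2"
  shows "deg F v = card {z. {v, z} \<in> F}"
proof -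
  have "bij_betw (\<lambda>z. {v, z}) {z. {v, z} \<in> F} {e \<in> F. v \<in> e}"
    unfolding bij_betw_def
  proof
    show "inj_on (\<lambda>z. {v, z}) {z. {v, z} \<in> F}" by (auto simp: inj_on_def doubleton_eq_iff)
    show "(\<lambda>z. {v, z}) ` {z. {v, z} \<in> F} = {e \<in> F. v \<in> e}"
    proof
      show "{e \<in> F. v \<in> e} \<subseteq> (\<lambda>z. {v, z}) ` {z. {v, z} \<in> F}"
      proof
        fix e assume e: "e \<in> {e \<in> F. v \<in> e}"
        then obtain a b where "e = {a, b}" using assms by (auto simp: card_2_iff)
        then have "\<exists>z. e = {v, z}" using e by (auto simp: insert_commute)
        then show "e \<in> (\<lambda>z. {v, z}) ` {z. {v, z} \<in> F}" using e by auto
      qed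
    qed auto
  qed
  then show ?thesis by (simp add: deg_def bij_betw_same_card)
qed

text \<open>Strip the common beginning. Where the paths diverge, follow \<open>q\<close> until it
  first returns to \<open>p\<close>; this detour and the matching part of \<open>p\<close> form the
  cycle.\<close>

lemma two_paths_cycle:
  assumes "distinct p" "distinct q" "p \<noteq> []" "q \<noteq> []" "hd p = hd q" "last p = last q" "p \<noteq> q"
    "edges p \<subseteq> F" "edges q \<subseteq> F"
  shows "\<exists>c. cyc F c \<and> set c \<subseteq> set p \<union> set q"
  using assms
proof (induction p arbitrary: q)
  case Nil
  then show ?case by simp
next
  case (Cons x p)
  obtain q' where q: "q = x # q'" using Cons.prems by (cases q) auto
  have p0: "p \<noteq> []" and q0: "q' \<noteq> []"
    using Cons.prems q by (auto split: if_splits dest: last_in_set)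
  show ?case
  proof (cases "hd p = hd q'")
    case True
    have "\<exists>c. cyc F c \<and> set c \<subseteq> set p \<union> set q'"
      by (rule Cons.IH) (use Cons.prems q p0 q0 True in \<open>auto simp: edges_Cons\<close>)
    then show ?thesis using q by auto
  next
    case False
    have "last q' \<in> set p" using Cons.prems q p0 q0 by (metis last.simps last_in_set)
    then have "\<exists>z\<in>set q'. z \<in> set p" using q0 by auto
    then obtain N v r where N: "q' = N @ v # r" "v \<in> set p" "\<forall>z\<in>set N. z \<notin> set p"
      using split_list_first_prop[of q' "\<lambda>z. z \<in> set p"] by blast
    obtain M s where M: "p = M @ v # s" using N(2) by (meson split_list)
    have "N \<noteq> [] \<or> M \<noteq> []" using False N M by auto
    moreover have "edges (x # M @ [v]) \<subseteq> F"
      using edges_append_mid[of "x # M" v s] Cons.prems M by simp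
    moreover have "edges (x # N @ [v]) \<subseteq> F"
      using edges_append_mid[of "x # N" v r] Cons.prems N q by simp
    ultimately have "cyc F (x # M @ v # rev N)"
      by (intro cyc_glue) (use Cons.prems q N M in \<open>auto simp: edges_rev_path\<close>)
    then show ?thesis using q N M by (intro exI[of _ "x # M @ v # rev N"]) auto
  qed
qed

lemma branch_vertices_finite:
  assumes "finite F" "\<forall>e\<in>F. card e = 2"
  shows "finite (\<Union>F)" "finite {v. deg F v = 3}" "{v. deg F v = 3} \<subseteq> \<Union>F"
proof -
  show "finite (\<Union>F)"
    by (rule finite_Union) (use assms in \<open>auto intro: card_ge_0_finite\<close>)
  moreover show "{v. deg F v = 3} \<subseteq> \<Union>F"
  proof
    fix v assume "v \<in> {v. deg F v = 3}"
    then show "v \<in> \<Union>F" using deg_0[of v F] by force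
  qed
  ultimately show "finite {v. deg F v = 3}" by (rule finite_subset[rotated])
qed

text \<open>If there is no such cycle, a path starting at a branch vertex and meeting \<open>j\<close> branch vertices extends in
  \<open>2 ^ (r + 1 - j)\<close> ways to a path ending at its \<open>(r + 1)\<close>-st branch vertex, and
  these paths have different ends.\<close>

lemma short_branch_cycle:
  assumes fin: "finite F" and two: "\<forall>e\<in>F. card e = 2" and ne: "F \<noteq> {}"
    and degs: "\<forall>v\<in>\<Union>F. deg F v = 2 \<or> deg F v = 3" and r: "1 \<le> r"
    and small: "card {v. deg F v = 3} < 2 ^ r"
  shows "\<exists>c. cyc F c \<and> card {v \<in> set c. deg F v = 3} \<le> 2 * r"
proof (rule ccontr)
  assume no: "\<not> ?thesis"
  define B where "B = {v. deg F v = 3}"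
  have finB: "finite B" and finV: "finite (\<Union>F)" and BV: "B \<subseteq> \<Union>F"
    using branch_vertices_finite[OF fin two] by (auto simp: B_def)
  have no': "2 * r < card (set c \<inter> B)" if "cyc F c" for c
  proof -
    have "{v \<in> set c. deg F v = 3} = set c \<inter> B" by (auto simp: B_def)
    then show ?thesis using no that by (metis not_le)
  qed
  define Ext where "Ext p = {q. distinct q \<and> set q \<subseteq> \<Union>F \<and> edges q \<subseteq> F \<and> (\<exists>s. q = p @ s) \<and>
    last q \<in> B \<and> card (set q \<inter> B) = Suc r}" for p
  have finE: "finite (Ext p)" for p
    by (rule finite_subset[OF _ finite_subset_distinct[OF finV]]) (auto simp: Ext_def)
  \<comment> \<open>The exponent counts the doublings still to come: one at each branch vertex from
    which the path continues, up to the \<open>r\<close>-th. If \<open>p\<close> ends at a branch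
    vertex, the choice there is still open, which accounts for the additional one.\<close>
  have ext: "2 ^ (if last p \<in> B then Suc r - card (set p \<inter> B) else r - card (set p \<inter> B)) \<le> card (Ext p)"
    if "p \<noteq> []" "distinct p" "set p \<subseteq> \<Union>F" "edges p \<subseteq> F"
      "card (set p \<inter> B) \<le> (if last p \<in> B then Suc r else r)" for p
    using that
  proof (induction "card (\<Union>F) - length p" arbitrary: p rule: less_induct)
    case less
    let ?j = "card (set p \<inter> B)"
    define w where "w = last p"
    show ?case
    proof (cases "w \<in> B \<and> ?j = Suc r")
      case True
      then have "p \<in> Ext p" using less.prems by (auto simp: Ext_def w_def)
      then have "Ext p \<noteq> {}" by blast
      then show ?thesis using True finE[of p] by (simp add: w_def card_gt_0_iff Suc_le_eq)
    next
      case False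
      then have j: "?j \<le> r" using less.prems by (auto simp: w_def split: if_splits)
      have wV: "w \<in> \<Union>F" using less.prems(1,3) last_in_set[of p] unfolding w_def by blast
      define N where "N = {z. {w, z} \<in> F}"
      define ch where "ch = N - set p"
      have finN: "finite N" by (rule finite_subset[OF _ finV]) (auto simp: N_def)
      \<comment> \<open>A neighbour of the end \<open>w\<close> on \<open>p\<close> other than its
        predecessor would close a cycle with at most \<open>r\<close> branch vertices. Hence all
        neighbours of \<open>w\<close> but at most one continue the path.\<close>
      have inner: "N \<inter> set p \<subseteq> {last (butlast p)}"
      proof
        fix z assume z: "z \<in> N \<inter> set p"
        have "z \<noteq> w" using z two by (force simp: N_def)
        have p: "p = butlast p @ [w]" using less.prems by (simp add: w_def)
        then have "z \<in> set (butlast p)" using z \<open>z \<noteq> w\<close>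
          by (metis Int_iff Un_iff empty_iff empty_set insert_iff list.simps(15) set_append)
        then obtain A M where AM: "butlast p = A @ z # M" by (meson split_list)
        have pe: "p = A @ z # M @ [w]" using p AM by simp
        have "M = []"
        proof (rule ccontr)
          assume "M \<noteq> []"
          have "edges (z # M @ [w]) \<subseteq> F"
            using edges_append_mid[of A z "M @ [w]"] pe less.prems by simp
          then have "cyc F (z # M @ w # [])"
            by (intro cyc_glue) (use pe less.prems z \<open>M \<noteq> []\<close> in \<open>auto simp: N_def\<close>)
          then have "2 * r < card (set (z # M @ [w]) \<inter> B)" using no' by blast
          also have "\<dots> \<le> ?j" by (rule card_mono) (use pe in auto)
          finally show False using j by simp
        qed
        then show "z \<in> {last (butlast p)}" using AM by simp
      qed
      have "card (N \<inter> set p) \<le> 1" using card_mono[OF _ inner] by simp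
      moreover have "card N = card ch + card (N \<inter> set p)"
        using finN by (metis ch_def card_Diff_subset_Int card_mono finite_Int inf_le1 le_add_diff_inverse2)
      moreover have "card N = (if w \<in> B then 3 else 2)"
      proof -
        have "deg F w = 2 \<or> deg F w = 3" using degs wV by blast
        then show ?thesis using deg_neighbours[OF two, of w] by (auto simp: N_def B_def)
      qed
      ultimately have ch: "(if w \<in> B then 2 else 1) \<le> card ch" by (auto split: if_splits)
      have "2 ^ (r - ?j) \<le> card (Ext (p @ [z]))" if "z \<in> ch" for z
      proof -
        have z: "z \<notin> set p" "{w, z} \<in> F" using that by (auto simp: ch_def N_def)
        have zV: "z \<in> \<Union>F" using z by blast
        have "length (p @ [z]) \<le> card (\<Union>F)"
          using card_mono[OF finV, of "set (p @ [z])"] distinct_card[of "p @ [z]"] less.prems z zV by simp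
        then have m: "card (\<Union>F) - length (p @ [z]) < card (\<Union>F) - length p" by simp
        have e: "edges (p @ [z]) \<subseteq> F" using less.prems z by (simp add: edges_append w_def)
        have c: "card (set (p @ [z]) \<inter> B) = (if z \<in> B then Suc ?j else ?j)"
          using z finB by (simp add: Int_insert_left)
        show ?thesis
          using less.hyps[OF m] less.prems z zV e j unfolding c by (cases "z \<in> B") simp_all
      qed
      then have "card ch * 2 ^ (r - ?j) \<le> (\<Sum>z\<in>ch. card (Ext (p @ [z])))"
        using sum_bounded_below[of ch "2 ^ (r - ?j)" "\<lambda>z. card (Ext (p @ [z]))"] by simp
      also have "\<dots> = card (\<Union>z\<in>ch. Ext (p @ [z]))"
      proof (rule card_UN_disjoint[symmetric])
        show "finite ch" using finN by (simp add: ch_def)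
        show "\<forall>z\<in>ch. \<forall>z'\<in>ch. z \<noteq> z' \<longrightarrow> Ext (p @ [z]) \<inter> Ext (p @ [z']) = {}"
          by (auto simp: Ext_def)
      qed (simp add: finE)
      also have "\<dots> \<le> card (Ext p)"
        by (rule card_mono[OF finE]) (auto simp: Ext_def)
      finally have *: "card ch * 2 ^ (r - ?j) \<le> card (Ext p)" .
      show ?thesis
      proof (cases "w \<in> B")
        case True
        then have "2 \<le> card ch" using ch by simp
        from order_trans[OF mult_le_mono1[OF this] *] show ?thesis
          using True j by (simp add: w_def Suc_diff_le)
      next
        case f: False
        then have "1 \<le> card ch" using ch by simp
        from order_trans[OF mult_le_mono1[OF this] *] show ?thesis
          using f by (simp add: w_def)
      qed
    qed
  qed
  show False
  proof (cases "B = {}")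
    case True
    have "\<Union>F \<noteq> {}" using ne two by fastforce
    then obtain v where "v \<in> \<Union>F" by blast
    then have "2 ^ r \<le> card (Ext [v])" using ext[of "[v]"] True by simp
    moreover have "Ext [v] = {}" using True by (simp add: Ext_def)
    ultimately show ?thesis by simp
  next
    case False
    then obtain v where v: "v \<in> B" by blast
    then have "2 ^ r \<le> card (Ext [v])" using ext[of "[v]"] BV by auto
    moreover have "card (Ext [v]) \<le> card B"
    proof (rule card_inj_on_le[of last])
      show "last ` Ext [v] \<subseteq> B" by (auto simp: Ext_def)
      show "inj_on last (Ext [v])"
      proof (rule inj_onI, rule ccontr)
        fix p q assume pq: "p \<in> Ext [v]" "q \<in> Ext [v]" "last p = last q" "p \<noteq> q"
        then have "distinct p" "distinct q" "p \<noteq> []" "q \<noteq> []" "hd p = hd q"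
          "edges p \<subseteq> F" "edges q \<subseteq> F" by (auto simp: Ext_def)
        then obtain c where c: "cyc F c" "set c \<subseteq> set p \<union> set q"
          using two_paths_cycle[of p q F] pq(3,4) by blast
        \<comment> \<open>Each path carries \<open>r + 1\<close> branch vertices, and both contain
          \<open>v\<close> and the common end; so the union carries at most 2(r+1) - 2 = 2r of
          them.\<close>
        have "card (set c \<inter> B) \<le> card ((set p \<inter> B) \<union> (set q \<inter> B))"
          by (rule card_mono) (use c in auto)
        moreover have "card (set p \<inter> B) + card (set q \<inter> B) =
          card ((set p \<inter> B) \<union> (set q \<inter> B)) + card ((set p \<inter> B) \<inter> (set q \<inter> B))"
          by (rule card_Un_Int) auto
        moreover have "2 \<le> card ((set p \<inter> B) \<inter> (set q \<inter> B))"
        proof -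
          have "last p \<noteq> v"
          proof
            assume "last p = v"
            moreover obtain s where "p = v # s" "distinct p" using pq by (auto simp: Ext_def)
            ultimately have "p = [v]" by (metis distinct.simps(2) last.simps last_in_set)
            then show False using pq v r by (simp add: Ext_def)
          qed
          then have "card {v, last p} = 2" by simp
          moreover have "p \<noteq> []" "q \<noteq> []" "hd p = v" "hd q = v" "last p \<in> B"
            using pq by (auto simp: Ext_def)
          then have "last q \<in> set q" "last p \<in> set p" "v \<in> set p" "v \<in> set q" "last p \<in> B"
            using hd_in_set[of p] hd_in_set[of q] by auto
          ultimately show ?thesis using pq v
            by (metis (no_types, lifting) card_mono finite_Int List.finite_set Int_iff empty_subsetI insert_subset)
        qed
        ultimately have "card (set c \<inter> B) \<le> 2 * r"
          using pq by (simp add: Ext_def)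
        then show False using no'[OF c(1)] by simp
      qed
    qed (rule finB)
    ultimately show ?thesis using small by (simp add: B_def)
  qed
qed

text \<open>A cycle with at most \<open>2 * r\<close> branch vertices is incident to at most \<open>2 * r\<close> edges
  outside it, so deleting its vertices costs at most \<open>2 * r\<close> of the excess
  \<open>card F - card (\<Union>F)\<close>; pruning vertices of degree \<open>1\<close> does not decrease the excess.\<close>

lemma excess_step:
  assumes fin: "finite F" and two: "\<forall>e\<in>F. card e = 2" and le3: "\<forall>v. deg F v \<le> 3" and r: "1 \<le> r"
    and small: "card {v. deg F v = 3} < 2 ^ r" and ex: "card (\<Union>F) + 2 * r * i + 1 \<le> card F"
  obtains c G where "cyc F c" "G \<subseteq> F" "\<forall>e\<in>G. e \<inter> set c = {}"
    "card (\<Union>G) + 2 * r * i + 1 \<le> card G + 2 * r"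
proof -
  define P where "P F' \<longleftrightarrow> F' \<subseteq> F \<and> card (\<Union>F') + 2 * r * i + 1 \<le> card F'" for F'
  have "P F" using ex by (simp add: P_def)
  \<comment> \<open>Choosing a minimal subgraph with this excess replaces the pruning: an edge at a
    vertex of degree one could be removed together with that vertex.\<close>
  then obtain G where G: "P G" and min: "\<And>F'. P F' \<Longrightarrow> card G \<le> card F'"
    using ex_has_least_nat[of P F card] by blast
  have GF: "G \<subseteq> F" and exG: "card (\<Union>G) + 2 * r * i + 1 \<le> card G" using G by (auto simp: P_def)
  have finG: "finite G" and twoG: "\<forall>e\<in>G. card e = 2" using GF fin two finite_subset by blast+
  note finVG = branch_vertices_finite(1)[OF finG twoG]
  have leG: "deg G v \<le> deg F v" for v using deg_mono[OF fin GF] .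
  have deg23: "deg G v = 2 \<or> deg G v = 3" if v: "v \<in> \<Union>G" for v
  proof -
    have "deg G v \<noteq> 1"
    proof
      assume "deg G v = 1"
      then obtain e where e: "{e \<in> G. v \<in> e} = {e}" by (auto simp: deg_def card_1_singleton_iff)
      then have eG: "e \<in> G" by blast
      have "\<Union>(G - {e}) \<subseteq> \<Union>G - {v}" using e by blast
      then have "card (\<Union>(G - {e})) \<le> card (\<Union>G) - 1"
        using card_mono[of "\<Union>G - {v}" "\<Union>(G - {e})"] finVG v by simp
      moreover have "0 < card (\<Union>G)" using finVG v by (auto simp: card_gt_0_iff)
      moreover have "card (G - {e}) = card G - 1" using finG eG by simp
      ultimately have "P (G - {e})" using exG GF by (auto simp: P_def)
      then show False using min[of "G - {e}"] \<open>card (G - {e}) = card G - 1\<close> exG by simp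
    qed
    then show ?thesis using deg_pos[OF finG v] leG[of v] le3 by (metis One_nat_def Suc_1 Suc_eq_numeral
      le_SucE le_trans less_Suc_eq_le not_less_zero numeral_3_eq_3 le_zero_eq)
  qed
  moreover have "{v. deg G v = 3} \<subseteq> {v. deg F v = 3}"
  proof
    fix v assume "v \<in> {v. deg G v = 3}"
    then show "v \<in> {v. deg F v = 3}" using leG[of v] le3[rule_format, of v] by simp
  qed
  then have smallG: "card {v. deg G v = 3} < 2 ^ r"
    using small card_mono[OF branch_vertices_finite(2)[OF fin two]] by (meson le_less_trans)
  moreover have "G \<noteq> {}" using exG by auto
  ultimately obtain c where c: "cyc G c" "card {v \<in> set c. deg G v = 3} \<le> 2 * r"
    using short_branch_cycle[OF finG twoG _ _ \<open>1 \<le> r\<close>] by blast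
  define T where "T = {e \<in> G. e \<inter> set c \<noteq> {}}"
  have cG: "cedges c \<subseteq> G" using c by (simp add: cyc_def)
  have cne: "c \<noteq> []" using c by (auto simp: cyc_def)
  have len: "card (set c) = length c" using c by (simp add: cyc_def distinct_card)
  have cV: "set c \<subseteq> \<Union>G" using Union_cedges[OF cne] cG by blast
  \<comment> \<open>Count incidences with the vertices of \<open>c\<close>: every edge of
    \<open>T\<close> gives at least one, and the edges of \<open>c\<close> itself give two. The
    total is the degree sum over \<open>c\<close>.\<close>
  have "card T + length c \<le> 2 * length c + 2 * r"
  proof -
    have "card T + length c = (\<Sum>e\<in>G. (if e \<in> T then 1 else 0) + (if e \<in> cedges c then 1 else 0))"
    proof -
      have "G \<inter> {e. e \<in> T} = T" "G \<inter> {e. e \<in> cedges c} = cedges c" using cG by (auto simp: T_def)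
      then show ?thesis using finG card_cedges[OF c(1)] by (simp add: sum.distrib sum.If_cases)
    qed
    also have "\<dots> \<le> (\<Sum>e\<in>G. card (e \<inter> set c))"
    proof (rule sum_mono)
      fix e assume e: "e \<in> G"
      show "(if e \<in> T then 1 else 0) + (if e \<in> cedges c then 1 else 0) \<le> card (e \<inter> set c)"
      proof (cases "e \<in> cedges c")
        case True
        then have "e \<inter> set c = e" using Union_cedges[OF cne] by blast
        then show ?thesis using twoG e by simp
      next
        case False
        have "e \<in> T \<Longrightarrow> 0 < card (e \<inter> set c)" by (auto simp: T_def card_gt_0_iff)
        then show ?thesis using False by auto
      qed
    qed
    also have "\<dots> = (\<Sum>v\<in>set c. deg G v)" using handshake[OF finG] by simp
    also have "\<dots> = (\<Sum>v\<in>set c. 2 + (if deg G v = 3 then 1 else 0))"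
    proof (rule sum.cong)
      fix v assume "v \<in> set c"
      then have "deg G v = 2 \<or> deg G v = 3" using deg23 cV by blast
      then show "deg G v = 2 + (if deg G v = 3 then 1 else 0)" by auto
    qed simp
    also have "\<dots> = 2 * length c + card {v \<in> set c. deg G v = 3}"
    proof -
      have "(\<Sum>v\<in>set c. if deg G v = 3 then 1 else 0) = card {v \<in> set c. deg G v = 3}"
        by (simp add: sum.If_cases Int_def)
      then show ?thesis unfolding sum.distrib using len by simp
    qed
    finally show ?thesis using c by simp
  qed
  then have cT: "card T \<le> length c + 2 * r" by simp
  define G' where "G' = {e \<in> G. e \<inter> set c = {}}"
  have "G = G' \<union> T" "G' \<inter> T = {}" "finite T" "finite G'" using finG by (auto simp: G'_def T_def)
  then have cG': "card G = card G' + card T" using card_Un_disjoint[of G' T] by simp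
  have cyc0: "cyc F c" using cyc_mono[OF c(1) GF] .
  have sub: "\<Union>G' \<subseteq> \<Union>G - set c" by (auto simp: G'_def)
  then have "card (\<Union>G') \<le> card (\<Union>G) - length c"
    using card_mono[OF _ sub] finVG card_Diff_subset[OF _ cV] len by simp
  moreover have "length c \<le> card (\<Union>G)" using card_mono[OF finVG cV] len by simp
  ultimately have exG': "card (\<Union>G') + 2 * r * i + 1 \<le> card G' + 2 * r"
    using cG' cT exG by linarith
  show thesis
    by (rule that[OF cyc0 _ _ exG']) (use GF in \<open>auto simp: G'_def\<close>)
qed

text \<open>Each removal of a cycle costs at most \<open>2 * r\<close> of the excess, and an excess
  of one is enough for the last cycle.\<close>

lemma excess_packing:
  assumes "finite F" "\<forall>e\<in>F. card e = 2" "\<forall>v. deg F v \<le> 3" "1 \<le> r"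
    "card {v. deg F v = 3} < 2 ^ r" "card (\<Union>F) + 2 * r * i + 1 \<le> card F"
  shows "packing F 0 (Suc i)"
  using assms
proof (induction i arbitrary: F)
  case 0
  obtain c G where "cyc F c" by (rule excess_step[OF 0])
  then show ?case unfolding packing_def by (intro exI[of _ "[c]"]) simp
next
  case (Suc i)
  note fin = Suc.prems(1) and two = Suc.prems(2) and le3 = Suc.prems(3) and small = Suc.prems(5)
  obtain c G where c: "cyc F c" and GF: "G \<subseteq> F" and G: "\<forall>e\<in>G. e \<inter> set c = {}"
    and exG: "card (\<Union>G) + 2 * r * Suc i + 1 \<le> card G + 2 * r"
    by (rule excess_step[OF Suc.prems])
  have le: "deg G v \<le> deg F v" for v using deg_mono[OF fin GF] .
  have "{v. deg G v = 3} \<subseteq> {v. deg F v = 3}"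
  proof
    fix v assume "v \<in> {v. deg G v = 3}"
    then show "v \<in> {v. deg F v = 3}" using le[of v] le3[rule_format, of v] by simp
  qed
  then have "card {v. deg G v = 3} < 2 ^ r"
    using small card_mono[OF branch_vertices_finite(2)[OF fin two]] by (meson le_less_trans)
  moreover have "\<forall>v. deg G v \<le> 3" using le le3 le_trans by blast
  moreover have "card (\<Union>G) + 2 * r * i + 1 \<le> card G" using exG by simp
  ultimately have "packing G 0 (Suc i)"
    by (intro Suc.IH finite_subset[OF GF fin] Suc.prems(4)) (use two GF in auto)
  then obtain Cs where Cs: "length Cs = Suc i" "\<forall>d\<in>set Cs. cyc G d"
    "sorted_wrt (\<lambda>c d. set c \<inter> set d = {}) Cs" by (auto simp: packing_def)
  have "set c \<inter> set d = {}" if "d \<in> set Cs" for d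
  proof -
    have "d \<noteq> []" "cedges d \<subseteq> G" using Cs(2) that by (auto simp: cyc_def)
    then show ?thesis using Union_cedges[of d] G by blast
  qed
  then show ?case
    unfolding packing_def using Cs c cyc_mono[OF _ GF]
    by (intro exI[of _ "c # Cs"]) auto
qed

subsection \<open>Edges lying on a common short cycle\<close>

lemma cycle_arcs:
  assumes "cyc F c" "x \<in> set c" "y \<in> set c" "x \<noteq> y"
  obtains a b where "distinct (x # a @ [y])" "distinct (x # b @ [y])" "set a \<inter> set b = {}"
    "set c = {x, y} \<union> set a \<union> set b" "length c = length a + length b + 2"
    "cedges c = edges (x # a @ [y]) \<union> edges (x # b @ [y])"
proof -
  obtain a b where "distinct (x # a @ y # b)" "set c = set (x # a @ y # b)"
    "length c = length a + length b + 2"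
    "cedges c = edges (x # a @ [y]) \<union> edges (y # b @ [x])" using cycle_split[OF assms] .
  then show ?thesis by (intro that[of a "rev b"]) (auto simp: edges_rev_path)
qed

lemma cyc_glue_paths:
  assumes "distinct (x # a @ [y])" "distinct (x # b @ [y])" "set a \<inter> set b = {}" "a \<noteq> [] \<or> b \<noteq> []"
    "edges (x # a @ [y]) \<subseteq> F" "edges (x # b @ [y]) \<subseteq> F"
  shows "cyc F (x # a @ y # rev b)"
    "cedges (x # a @ y # rev b) = edges (x # a @ [y]) \<union> edges (x # b @ [y])"
    "length (x # a @ y # rev b) = length a + length b + 2"
  using assms by (auto intro!: cyc_glue simp: edges_rev_path cedges_split)

lemma edge_meets_interior: "e \<in> edges (x # Q @ [y]) \<Longrightarrow> Q \<noteq> [] \<Longrightarrow> e \<inter> set Q \<noteq> {}"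
proof (induction Q arbitrary: x)
  case (Cons z Q)
  then show ?case by (cases "Q = []") auto
qed simp

lemma closed_walk_from:
  assumes "cyc F c" "{x, b} \<in> cedges c"
  obtains m where "distinct (x # b # m)" "cedges c = edges (x # b # m @ [x])" "set c = set (x # b # m)"
proof -
  obtain s m t where smt: "cyc F (s # m @ [t])" "{x, b} = {t, s}" "set (s # m @ [t]) = set c"
    "cedges (s # m @ [t]) = cedges c" using cycle_edge_start[OF assms] by metis
  have d: "distinct (s # m @ [t])" using smt(1) by (simp add: cyc_def)
  consider "x = t" "b = s" | "x = s" "b = t" using smt(2) by (auto simp: doubleton_eq_iff)
  then show ?thesis
  proof cases
    case 1
    have "cedges c = edges (t # s # m @ [t])"
      using smt(4) cedges_rotate[of "s # m" "[t]"] by (simp add: cedges_def)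
    then show ?thesis by (intro that[of m]) (use 1 d smt in auto)
  next
    case 2
    have "edges (s # t # rev m @ [s]) = edges (rev (s # t # rev m @ [s]))" by (rule edges_rev[symmetric])
    also have "\<dots> = cedges c" using smt(4) by (simp add: cedges_def)
    finally show ?thesis by (intro that[of "rev m"]) (use 2 d smt in auto)
  qed
qed

locale gap_graph =
  fixes F :: "'a set set" and l :: nat
  assumes finF: "finite F" and two: "\<forall>e\<in>F. card e = 2" and l3: "3 \<le> l"
    and gap: "cyc F c \<Longrightarrow> length c < l \<or> 6 * l < length c"
begin

definition eqv :: "'a set \<Rightarrow> 'a set \<Rightarrow> bool" where
  "eqv e f \<longleftrightarrow> e = f \<or> (\<exists>c. cyc F c \<and> length c < l \<and> e \<in> cedges c \<and> f \<in> cedges c)"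

lemma eqv_refl [simp]: "eqv e e"
  by (simp add: eqv_def)

lemma eqv_sym: "eqv e f \<Longrightarrow> eqv f e"
  by (auto simp: eqv_def)

lemma eqv_cycle: "cyc F c \<Longrightarrow> length c < l \<Longrightarrow> e \<in> cedges c \<Longrightarrow> f \<in> cedges c \<Longrightarrow> eqv e f"
  by (auto simp: eqv_def)

text \<open>Two short cycles sharing an edge contain fewer than \<open>2 * l\<close> vertices, so by the gap
  every cycle in their union is short.\<close>

lemma eqv_trans:
  assumes "eqv e f" "eqv f g"
  shows "eqv e g"
proof (cases "e = f \<or> f = g")
  case True
  then show ?thesis using assms by auto
next
  case False
  then obtain c d where c: "cyc F c" "length c < l" "e \<in> cedges c" "f \<in> cedges c"
    and d: "cyc F d" "length d < l" "f \<in> cedges d" "g \<in> cedges d"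
    using assms by (auto simp: eqv_def)
  show ?thesis
  proof (cases "g \<in> cedges c")
    case True
    then show ?thesis using c eqv_cycle by blast
  next
    case g: False
    have ne: "c \<noteq> []" "d \<noteq> []" using c d by (auto simp: cyc_def)
    have "card f = 2" using two c by (auto simp: cyc_def)
    then obtain p q where f: "f = {p, q}" "p \<noteq> q" by (auto simp: card_2_iff)
    then have "p \<in> set d" "q \<in> set d" "p \<in> set c" "q \<in> set c"
      using Union_cedges[OF ne(1)] Union_cedges[OF ne(2)] c d by auto
    then obtain x y Q B where Q: "x \<in> set c" "y \<in> set c" "set Q \<inter> set c = {}" "distinct (x # Q @ y # B)"
      "g \<in> edges (x # Q @ [y])" "cedges d = edges (x # Q @ [y]) \<union> edges (y # B @ [x])"
      "length d = length Q + length B + 2"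
      using ear_through[OF d(1,4), of p q "set c"] f by metis
    have "x \<noteq> y" using Q by auto
    then obtain a b where ab: "distinct (x # a @ [y])" "distinct (x # b @ [y])" "set a \<inter> set b = {}"
      "set c = {x, y} \<union> set a \<union> set b" "length c = length a + length b + 2"
      "cedges c = edges (x # a @ [y]) \<union> edges (x # b @ [y])" using cycle_arcs[OF c(1) Q(1,2)] by metis
    \<comment> \<open>The part \<open>Q\<close> of \<open>d\<close> is an ear of \<open>c\<close>
      through \<open>g\<close>. It is closed up by whichever arc \<open>s\<close> of
      \<open>c\<close> contains \<open>e\<close>, giving a cycle through both edges.\<close>
    have arc: "eqv e g" if e: "e \<in> edges (x # s @ [y])" and s: "distinct (x # s @ [y])"
      "set s \<subseteq> set c" "edges (x # s @ [y]) \<subseteq> cedges c" "length s + 2 \<le> length c" for s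
    proof -
      have "s \<noteq> [] \<or> Q \<noteq> []" using s Q g by auto
      moreover have "distinct (x # Q @ [y])" "set s \<inter> set Q = {}" using Q(3,4) s(2) by auto
      moreover have "edges (x # s @ [y]) \<subseteq> F" "edges (x # Q @ [y]) \<subseteq> F"
        using c(1) d(1) s(3) Q(6) by (auto simp: cyc_def)
      ultimately have *: "cyc F (x # s @ y # rev Q)"
        "cedges (x # s @ y # rev Q) = edges (x # s @ [y]) \<union> edges (x # Q @ [y])"
        "length (x # s @ y # rev Q) = length s + length Q + 2"
        using cyc_glue_paths[of x s y Q F] s(1) by blast+
      then have "length (x # s @ y # rev Q) < 2 * l" using s(4) Q(7) c(2) d(2) by linarith
      then have "length (x # s @ y # rev Q) < l" using gap[OF *(1)] by linarith
      then show ?thesis using eqv_cycle[OF *(1)] *(2) e Q(5) by blast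
    qed
    from c(3) ab(6) consider "e \<in> edges (x # a @ [y])" | "e \<in> edges (x # b @ [y])" by blast
    then show ?thesis using arc[of a] arc[of b] ab by cases auto
  qed
qed

text \<open>A shortest counterexample \<open>c\<close> is isometric with respect to paths inside the class: the
  chord \<open>N\<close> in \<open>jump\<close> splits it into two strictly shorter cycles, which must both be short. A short
  cycle through two distant edges of \<open>c\<close> is then too short to lead from one to the other.\<close>

lemma class_short:
  assumes "cyc F c0" "\<forall>e\<in>cedges c0. eqv e0 e"
  shows "length c0 < l"
proof (rule ccontr)
  assume "\<not> length c0 < l"
  define P where "P c \<longleftrightarrow> cyc F c \<and> l \<le> length c \<and> (\<forall>e\<in>cedges c. eqv e0 e)" for c
  have "P c0" using assms \<open>\<not> length c0 < l\<close> by (simp add: P_def)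
  then obtain c where c: "P c" and min: "\<And>d. P d \<Longrightarrow> length c \<le> length d"
    using ex_has_least_nat[of P c0 length] by blast
  define n where "n = length c"
  have cyc: "cyc F c" and cl: "\<And>e. e \<in> cedges c \<Longrightarrow> eqv e0 e" using c by (auto simp: P_def)
  have n: "6 * l < n" using gap[OF cyc] c by (auto simp: P_def n_def)
  have dc: "distinct c" using cyc by (simp add: cyc_def)
  have jump: "q - p \<le> length N + 1 \<or> n - (q - p) \<le> length N + 1"
    if pq: "p < q" "q < n" and N: "distinct (c ! p # N @ [c ! q])" "set N \<inter> set c = {}"
      "edges (c ! p # N @ [c ! q]) \<subseteq> F" "\<forall>e\<in>edges (c ! p # N @ [c ! q]). eqv e0 e" for p q N
  proof (rule ccontr)
    assume neg: "\<not> ?thesis"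
    define x y A M D where "x = c ! p" and "y = c ! q" and "A = take p c"
      and "M = take (q - p - 1) (drop (Suc p) c)" and "D = drop (Suc q) c"
    have "drop (Suc p) c = M @ y # D"
      using id_take_nth_drop[of "q - p - 1" "drop (Suc p) c"] pq
      by (simp add: M_def y_def D_def n_def)
    then have ceq: "c = A @ x # M @ y # D"
      using id_take_nth_drop[of p c] pq by (simp add: A_def x_def n_def)
    have lM: "length M = q - p - 1" and lA: "length A + length D = n - (q - p) - 1"
      using pq by (auto simp: M_def A_def D_def n_def)
    have ce: "cedges c = edges (x # M @ [y]) \<union> edges (y # (D @ A) @ [x])"
      using cedges_rotate[of A "x # M @ y # D"] cedges_split[of x M y "D @ A"] ceq by simp
    have ceF: "cedges c \<subseteq> F" using cyc by (simp add: cyc_def)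
    \<comment> \<open>The new cycle stays in the class and is shorter than \<open>c\<close>, so by
      minimality it is not a counterexample. For both arcs at once this would force n < 2l.\<close>
    have short: "length s + length N + 2 < l"
      if s: "s \<noteq> []" "distinct (x # s @ [y])" "set s \<inter> set N = {}" "edges (x # s @ [y]) \<subseteq> cedges c"
        "length s + length N + 2 < n" for s
    proof -
      have *: "cyc F (x # s @ y # rev N)"
        "cedges (x # s @ y # rev N) = edges (x # s @ [y]) \<union> edges (x # N @ [y])"
        "length (x # s @ y # rev N) = length s + length N + 2"
        using cyc_glue_paths[of x s y N F] s N ceF by (auto simp: x_def y_def)
      have "\<not> P (x # s @ y # rev N)" using min[of "x # s @ y # rev N"] s *(3) by (auto simp: n_def)
      then have "\<not> l \<le> length (x # s @ y # rev N)"
        using *(1) unfolding P_def *(2) using s(4) cl N(4) by (auto simp: x_def y_def)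
      then show ?thesis using *(3) by simp
    qed
    have "length M + length N + 2 < l"
      by (rule short) (use neg lM pq dc ceq N ce in auto)
    moreover have "length (rev (D @ A)) + length N + 2 < l"
      by (rule short) (use neg lA pq dc ceq N ce edges_rev_path[of x "D @ A" y] in auto)
    ultimately show False using lM lA n neg pq by simp
  qed
  \<comment> \<open>The integer \<open>\<delta>\<close> is the signed displacement along
    \<open>c\<close>, modulo \<open>n\<close>, accumulated by the path. By \<open>jump\<close> every
    segment between visits to \<open>c\<close> contributes at most its number of edges.\<close>
  have disp: "\<exists>i j \<delta>. i < n \<and> j < n \<and> hd q = c ! i \<and> last q = c ! j \<and> \<bar>\<delta>\<bar> < int (length q) \<and>
      int n dvd int j - int i - \<delta>"
    if "q \<noteq> []" "hd q \<in> set c" "last q \<in> set c" "distinct q" "edges q \<subseteq> F" "\<forall>e\<in>edges q. eqv e0 e" for q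
    using that
  proof (induction rule: path_induct)
    case (single x)
    then obtain i where "i < n" "x = c ! i" by (auto simp: in_set_conv_nth n_def)
    then show ?case by (intro exI[of _ i] exI[of _ i] exI[of _ 0]) simp
  next
    case (step x N v r)
    have sp: "edges (x # N @ v # r) = edges (x # N @ [v]) \<union> edges (v # r)"
      using edges_append_mid[of "x # N" v r] by simp
    obtain i' j \<delta> where IH: "i' < n" "j < n" "v = c ! i'" "last (v # r) = c ! j"
      "\<bar>\<delta>\<bar> < int (length (v # r))" "int n dvd int j - int i' - \<delta>"
      using step sp by auto
    obtain i where i: "i < n" "x = c ! i" using step by (auto simp: in_set_conv_nth n_def)
    have "i \<noteq> i'" using step i IH by auto
    have N: "distinct (x # N @ [v])" "edges (x # N @ [v]) \<subseteq> F" "\<forall>e\<in>edges (x # N @ [v]). eqv e0 e"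
      using step sp by auto
    obtain \<epsilon> :: int where \<epsilon>: "\<bar>\<epsilon>\<bar> \<le> int (length N) + 1" "int n dvd int i' - int i - \<epsilon>"
    proof (cases "i < i'")
      case True
      then have "i' - i \<le> length N + 1 \<or> n - (i' - i) \<le> length N + 1"
        using jump[of i i' N] N i IH step by auto
      then show ?thesis
      proof
        assume "i' - i \<le> length N + 1"
        then show ?thesis using True by (intro that[of "int i' - int i"]) auto
      next
        assume "n - (i' - i) \<le> length N + 1"
        then show ?thesis using True IH by (intro that[of "int i' - int i - int n"]) auto
      qed
    next
      case False
      then have "i' < i" using \<open>i \<noteq> i'\<close> by simp
      then have "i - i' \<le> length (rev N) + 1 \<or> n - (i - i') \<le> length (rev N) + 1"
        using jump[of i' i "rev N"] N i IH step edges_rev_path[of v N x] edges_rev_path[of x N v] by auto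
      then show ?thesis
      proof
        assume "i - i' \<le> length (rev N) + 1"
        then show ?thesis using \<open>i' < i\<close> by (intro that[of "int i' - int i"]) auto
      next
        assume "n - (i - i') \<le> length (rev N) + 1"
        then show ?thesis using \<open>i' < i\<close> i by (intro that[of "int i' - int i + int n"]) auto
      qed
    qed
    have "int n dvd (int j - int i' - \<delta>) + (int i' - int i - \<epsilon>)" using IH(6) \<epsilon>(2) by (rule dvd_add)
    then have "int n dvd int j - int i - (\<delta> + \<epsilon>)" by (simp add: algebra_simps)
    moreover have "\<bar>\<delta> + \<epsilon>\<bar> < int (length (x # N @ v # r))" using IH(5) \<epsilon>(1) by auto
    ultimately show ?case
      by (intro exI[of _ i] exI[of _ j] exI[of _ "\<delta> + \<epsilon>"]) (use i IH in auto)
  qed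
  have edge: "{c ! i, c ! Suc i} \<in> cedges c" if "Suc i < n" for i
  proof -
    have "{(c @ [hd c]) ! i, (c @ [hd c]) ! Suc i} \<in> cedges c"
      unfolding cedges_def edges_conv_nth using that by (auto simp: n_def)
    then show ?thesis using that by (simp add: nth_append n_def)
  qed
  \<comment> \<open>Positions 0 and 2l: an arc of a short cycle between these vertices has
    |\<delta>| < l, so 2l - \<delta> lies strictly between l and 3l and is not divisible by n >
    6l.\<close>
  define x y where "x = c ! 0" and "y = c ! (2 * l)"
  have idx: "0 < n" "1 < n" "2 * l < n" "Suc (2 * l) < n" using n l3 by auto
  have xy: "x \<noteq> y" "x \<noteq> c ! Suc (2 * l)" "x \<in> set c" "y \<in> set c"
    using dc idx l3 by (auto simp: x_def y_def n_def nth_eq_iff_index_eq)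
  have "eqv {x, c ! 1} {y, c ! Suc (2 * l)}"
    using eqv_trans[OF eqv_sym[OF cl] cl] edge[of 0] edge[of "2 * l"] idx
    by (simp add: x_def y_def)
  moreover have "{x, c ! 1} \<noteq> {y, c ! Suc (2 * l)}" using xy by auto
  ultimately obtain s where s: "cyc F s" "length s < l" "{x, c ! 1} \<in> cedges s"
    "{y, c ! Suc (2 * l)} \<in> cedges s" by (auto simp: eqv_def)
  have "s \<noteq> []" using s by (auto simp: cyc_def)
  then have "x \<in> set s" "y \<in> set s" using s Union_cedges[of s] by auto
  then obtain a b where ab: "distinct (x # a @ [y])" "length s = length a + length b + 2"
    "cedges s = edges (x # a @ [y]) \<union> edges (x # b @ [y])" using cycle_arcs[OF s(1)] xy(1) by metis
  have "eqv e0 e" if "e \<in> cedges s" for e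
  proof (rule eqv_trans)
    show "eqv e0 {x, c ! 1}" using cl[OF edge[of 0]] idx by (simp add: x_def)
    show "eqv {x, c ! 1} e" using eqv_cycle[OF s(1,2,3) that] .
  qed
  then obtain i j \<delta> where *: "i < n" "j < n" "x = c ! i" "y = c ! j" "\<bar>\<delta>\<bar> < int (length (x # a @ [y]))"
    "int n dvd int j - int i - \<delta>"
    using disp[of "x # a @ [y]"] ab xy s(1) by (auto simp: cyc_def)
  then have "i = 0" "j = 2 * l" using dc idx by (auto simp: x_def y_def n_def nth_eq_iff_index_eq)
  then have "int n dvd 2 * int l - \<delta>" using * by simp
  moreover have "\<bar>\<delta>\<bar> < int l" using * ab s by simp
  ultimately show False using zdvd_imp_le[of "int n" "2 * int l - \<delta>"] n by linarith
qed

end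

subsection \<open>Maximal subgraphs of degrees two and three without short cycles\<close>

lemma packing_index:
  assumes "finite I" "k \<le> card I" "\<And>i. i \<in> I \<Longrightarrow> cyc F (C i) \<and> l \<le> length (C i)"
    "\<And>i j. i \<in> I \<Longrightarrow> j \<in> I \<Longrightarrow> i \<noteq> j \<Longrightarrow> set (C i) \<inter> set (C j) = {}"
  shows "packing F l k"
proof -
  obtain xs where xs: "set xs = I" "distinct xs" using finite_distinct_list[OF assms(1)] by blast
  define ys where "ys = take k xs"
  have ys: "set ys \<subseteq> I" "distinct ys" "length ys = k"
    using xs assms(2) set_take_subset[of k xs] by (auto simp: ys_def distinct_card)
  have "sorted_wrt (\<lambda>c d. set c \<inter> set d = {}) (map C ys)"
    using ys(1,2) assms(4) by (induction ys) fastforce+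
  then show ?thesis
    unfolding packing_def using ys assms(3) by (intro exI[of _ "map C ys"]) auto
qed

locale skeleton = gap_graph +
  fixes H :: "'a set set"
  assumes HF: "H \<subseteq> F" and degH: "v \<in> \<Union>H \<Longrightarrow> deg H v = 2 \<or> deg H v = 3"
    and longH: "cyc H c \<Longrightarrow> l \<le> length c"
    and maxH: "H' \<subseteq> F \<Longrightarrow> (\<And>v. v \<in> \<Union>H' \<Longrightarrow> deg H' v = 2 \<or> deg H' v = 3) \<Longrightarrow>
      (\<And>c. cyc H' c \<Longrightarrow> l \<le> length c) \<Longrightarrow> card H' \<le> card H"
begin

lemma finH: "finite H"
  using HF finF by (rule finite_subset)

lemma twoH: "\<forall>e\<in>H. card e = 2"
  using HF two by blast

lemma deg2_in: "deg H v = 2 \<Longrightarrow> v \<in> \<Union>H"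
  using deg_0[of v H] by force

lemma deg_Un_disjoint:
  assumes "finite A" "finite B" "A \<inter> B = {}"
  shows "deg (A \<union> B) v = deg A v + deg B v"
proof -
  have "{e \<in> A \<union> B. v \<in> e} = {e \<in> A. v \<in> e} \<union> {e \<in> B. v \<in> e}" by blast
  then show ?thesis unfolding deg_def using assms by (simp add: card_Un_disjoint disjoint_iff)
qed

text \<open>Since the ends have degree two, \<open>H\<close> with the ear added still has degrees
  two and three. It is larger than \<open>H\<close>, so it must contain a short cycle, which uses
  the ear completely and returns through \<open>H\<close>.\<close>

lemma ear:
  assumes x: "deg H x = 2" and y: "deg H y = 2" and d: "distinct (x # Q @ [y])"
    and Q: "set Q \<inter> \<Union>H = {}" and E: "edges (x # Q @ [y]) \<subseteq> F" "edges (x # Q @ [y]) \<inter> H = {}"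
  shows "\<exists>R c. edges (x # R @ [y]) \<subseteq> H \<and> cyc F c \<and> length c < l \<and> length Q + 2 \<le> length c \<and>
    cedges c = edges (x # Q @ [y]) \<union> edges (x # R @ [y])"
proof -
  define E where "E = edges (x # Q @ [y])"
  have UE: "\<Union>E = {x, y} \<union> set Q" unfolding E_def by (subst Union_edges) auto
  have "E \<noteq> {}" using UE by auto
  then have "card H < card (H \<union> E)"
    using E finH card_Un_disjoint[of H E] by (simp add: E_def Int_commute card_gt_0_iff)
  moreover have "deg (H \<union> E) v = 2 \<or> deg (H \<union> E) v = 3" if "v \<in> \<Union>(H \<union> E)" for v
  proof -
    have s: "deg (H \<union> E) v = deg H v + deg E v"
      using E by (intro deg_Un_disjoint finH) (auto simp: E_def)
    have ex: "deg E x = 1" using path_edge_unique[OF d] by (simp add: deg_def E_def)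
    have "distinct (y # rev Q @ [x])" using d by auto
    then have "deg (edges (y # rev Q @ [x])) y = 1"
      unfolding deg_def by (subst path_edge_unique) auto
    then have ey: "deg E y = 1" by (simp add: edges_rev_path E_def)
    consider "v = x" | "v = y" | "v \<in> set Q" | "v \<notin> \<Union>E" using UE by blast
    then show ?thesis
    proof cases
      case 3
      then have "deg H v = 0" using Q by (intro deg_0) blast
      then show ?thesis using s deg_path_interior[OF d 3] by (simp add: E_def)
    next
      case 4
      then have "deg E v = 0" by (rule deg_0)
      then show ?thesis using s degH that 4 by auto
    qed (use s ex ey x y in auto)
  qed
  ultimately obtain c where c: "cyc (H \<union> E) c" "length c < l"
    using maxH[of "H \<union> E"] HF E by (metis E_def Un_least not_le)
  then have cF: "cyc F c" using cyc_mono[OF c(1)] HF E by (simp add: E_def)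
  have cne: "c \<noteq> []" and ce: "cedges c \<subseteq> H \<union> E" using c by (auto simp: cyc_def)
  have "\<not> cedges c \<subseteq> H" using longH[of c] c by (auto simp: cyc_def)
  then obtain g where g: "g \<in> cedges c" "g \<notin> H" by blast
  then have gE: "g \<in> E" using ce by blast
  \<comment> \<open>A cycle with at most one vertex in \<open>H\<close> has no edge of
    \<open>H\<close>, and would then lie in the path \<open>E\<close>.\<close>
  have "\<exists>u v. u \<in> set c \<and> v \<in> set c \<and> u \<noteq> v \<and> u \<in> \<Union>H \<and> v \<in> \<Union>H"
  proof (rule ccontr)
    assume neg: "\<not> ?thesis"
    have "e \<in> E" if e: "e \<in> cedges c" for e
    proof (rule ccontr)
      assume "e \<notin> E"
      then have "e \<in> H" using ce e by blast
      then obtain u v where "e = {u, v}" "u \<noteq> v" using twoH by (auto simp: card_2_iff)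
      moreover have "e \<subseteq> set c" using Union_cedges[OF cne] e by blast
      ultimately show False using neg \<open>e \<in> H\<close> by blast
    qed
    then have "cyc E c" using c by (auto simp: cyc_def)
    then show False using path_acyclic[OF d] by (simp add: E_def)
  qed
  then obtain u v where "u \<in> set c" "v \<in> set c" "u \<noteq> v" "u \<in> \<Union>H" "v \<in> \<Union>H" by blast
  then obtain x' y' Q' B where Q': "x' \<in> \<Union>H" "y' \<in> \<Union>H" "set Q' \<inter> \<Union>H = {}"
    "distinct (x' # Q' @ y' # B)" "g \<in> edges (x' # Q' @ [y'])"
    "cedges c = edges (x' # Q' @ [y']) \<union> edges (y' # B @ [x'])"
    "length c = length Q' + length B + 2"
    using ear_through[OF cF g(1), of u v "\<Union>H"] by metis
  \<comment> \<open>The stretch of \<open>c\<close> around \<open>g\<close> between vertices of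
    \<open>H\<close> consists of edges of the ear only; its ends must be \<open>x\<close> and
    \<open>y\<close>, so by \<open>path_unique\<close> it is the entire ear, possibly
    reversed.\<close>
  have sub: "edges (x' # Q' @ [y']) \<subseteq> E"
  proof
    fix e assume e: "e \<in> edges (x' # Q' @ [y'])"
    show "e \<in> E"
    proof (cases "Q' = []")
      case True
      then show ?thesis using e Q'(5) gE by simp
    next
      case False
      then have "e \<inter> set Q' \<noteq> {}" using edge_meets_interior[OF e] by simp
      then have "e \<notin> H" using Q'(3) by blast
      then show ?thesis using e Q'(6) ce by blast
    qed
  qed
  have "\<Union>(edges (x' # Q' @ [y'])) = {x', y'} \<union> set Q'" by (subst Union_edges) auto
  then have "x' \<in> {x, y} \<union> set Q" "y' \<in> {x, y} \<union> set Q" using sub UE by blast+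
  then have "x' \<in> {x, y}" "y' \<in> {x, y}" "x' \<noteq> y'" using Q Q' by auto
  then consider "x' = x" "y' = y" | "x' = y" "y' = x" by auto
  then obtain R where R: "distinct (x # R @ [y])" "set R \<inter> set Q = {}" "length c = length Q + length R + 2"
    "cedges c = E \<union> edges (x # R @ [y])"
  proof cases
    case 1
    then have "Q' = Q" using path_unique[OF d, of Q'] sub Q' by (simp add: E_def)
    then show ?thesis using that[of "rev B"] Q' 1 by (auto simp: edges_rev_path E_def)
  next
    case 2
    have e: "edges (x # rev Q' @ [y]) = edges (x' # Q' @ [y'])" using 2 by (simp add: edges_rev_path)
    then have "rev Q' = Q" using path_unique[OF d, of "rev Q'"] sub Q' 2 by (auto simp: E_def)
    then show ?thesis using that[of B] Q' 2 e by (auto simp: E_def Int_commute)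
  qed
  have "edges (x # R @ [y]) \<subseteq> H"
  proof
    fix e assume e: "e \<in> edges (x # R @ [y])"
    show "e \<in> H"
    proof (rule ccontr)
      assume "e \<notin> H"
      then have eE: "e \<in> E" using e R(4) ce by blast
      have eR: "e \<subseteq> {x, y} \<union> set R" using edges_subset[OF e] by auto
      have "Q = []"
      proof (rule ccontr)
        assume "Q \<noteq> []"
        then have "e \<inter> set Q \<noteq> {}" using edge_meets_interior eE by (metis E_def)
        then show False using eR R(2) d by auto
      qed
      then have "e = {x, y}" using eE by (simp add: E_def)
      moreover have "R \<noteq> []" using R(3) \<open>Q = []\<close> c by (auto simp: cyc_def)
      ultimately show False using edge_meets_interior[OF e] R(1) by auto
    qed
  qed
  then show ?thesis using R cF c(2) by (intro exI[of _ R] exI[of _ c]) (simp add: E_def)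
qed

text \<open>Extends \<open>ear\<close> to the case of a single edge of \<open>H\<close>, which is
  its own path \<open>R\<close>. Thus every stretch of a cycle between consecutive vertices of
  \<open>H\<close> of degree two has a shadow in \<open>H\<close> of the same class.\<close>

lemma ear_eqv:
  assumes "deg H x = 2" "deg H y = 2" "distinct (x # N @ [y])" "set N \<inter> \<Union>H = {}"
    "edges (x # N @ [y]) \<subseteq> F"
  shows "\<exists>R. edges (x # R @ [y]) \<subseteq> H \<and>
    (\<forall>e\<in>edges (x # N @ [y]) \<union> edges (x # R @ [y]). \<forall>f\<in>edges (x # N @ [y]) \<union> edges (x # R @ [y]). eqv e f)"
proof (cases "N = [] \<and> {x, y} \<in> H")
  case True
  then show ?thesis by (intro exI[of _ "[]"]) simp
next
  case False
  have "edges (x # N @ [y]) \<inter> H = {}"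
  proof (cases "N = []")
    case f: False
    then have "e \<notin> H" if "e \<in> edges (x # N @ [y])" for e
      using edge_meets_interior[OF that] assms(4) by blast
    then show ?thesis by blast
  qed (use False in simp)
  from ear[OF assms(1-5) this] obtain R c where R: "edges (x # R @ [y]) \<subseteq> H" and c: "cyc F c" "length c < l"
    and ce: "cedges c = edges (x # N @ [y]) \<union> edges (x # R @ [y])" by blast
  show ?thesis
    by (intro exI[of _ R] conjI R ballI eqv_cycle[OF c]) (use ce in auto)
qed

text \<open>A disjoint long cycle could be added to \<open>H\<close> as a whole: every cycle of the
  union lies in one of the two disjoint parts, so no short cycle arises.\<close>

lemma long_cycle_meets:
  assumes c: "cyc F c" "l \<le> length c"
  shows "set c \<inter> \<Union>H \<noteq> {}"
proof
  assume dis: "set c \<inter> \<Union>H = {}"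
  have cne: "c \<noteq> []" and ceF: "cedges c \<subseteq> F" using c by (auto simp: cyc_def)
  have U: "\<Union>(cedges c) = set c" by (rule Union_cedges[OF cne])
  have "{} \<notin> F" using two by auto
  have inter: "H \<inter> cedges c = {}"
  proof (rule equals0I)
    fix e assume e: "e \<in> H \<inter> cedges c"
    then have "e \<noteq> {}" using \<open>{} \<notin> F\<close> HF by auto
    moreover have "e \<subseteq> set c \<inter> \<Union>H" using e U by blast
    ultimately show False using dis by simp
  qed
  have "cedges c \<noteq> {}" using U cne by auto
  then have "card H < card (H \<union> cedges c)"
    using finH inter card_Un_disjoint[of H "cedges c"] by (simp add: card_gt_0_iff)
  moreover have "deg (H \<union> cedges c) v = 2 \<or> deg (H \<union> cedges c) v = 3"
    if "v \<in> \<Union>(H \<union> cedges c)" for v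
  proof -
    have s: "deg (H \<union> cedges c) v = deg H v + deg (cedges c) v"
      using inter finH by (intro deg_Un_disjoint) auto
    show ?thesis
    proof (cases "v \<in> set c")
      case True
      then have "deg H v = 0" using dis by (intro deg_0) blast
      then show ?thesis using s deg_cycle[OF c(1) True] by simp
    next
      case False
      then have "v \<notin> \<Union>(cedges c)" using U by simp
      then have "deg (cedges c) v = 0" "v \<in> \<Union>H" using that by (simp_all add: deg_0)
      then show ?thesis using s degH[of v] by simp
    qed
  qed
  moreover have "l \<le> length d" if d: "cyc (H \<union> cedges c) d" for d
  proof -
    have "edges (d @ [hd d]) \<subseteq> H \<or> edges (d @ [hd d]) \<subseteq> cedges c"
      using d U dis by (intro walk_disjoint_Un) (auto simp: cyc_def cedges_def)
    then consider "cyc H d" | "cedges d \<subseteq> cedges c" using d by (auto simp: cyc_def cedges_def)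
    then show ?thesis
    proof cases
      case 1
      then show ?thesis by (rule longH)
    next
      case 2
      then have "cedges d = cedges c" by (rule cycle_in_cycle[OF c(1) d])
      then show ?thesis using card_cedges[OF d] card_cedges[OF c(1)] c(2) by simp
    qed
  qed
  ultimately show False using maxH[of "H \<union> cedges c"] HF ceF by (metis Un_least not_le)
qed

text \<open>If the cycles met, one could go from \<open>x\<close> along an arc of \<open>c\<close>
  and then along \<open>d\<close> to \<open>y\<close>. This is an ear of \<open>H\<close>, and
  choosing the longer arc makes it too long to lie on a short cycle, against
  \<open>ear\<close>.\<close>

lemma pendant_disjoint:
  assumes c: "cyc F c" "l \<le> length c" "set c \<inter> \<Union>H = {x}"
    and d: "cyc F d" "l \<le> length d" "set d \<inter> \<Union>H = {y}"
    and xy: "x \<noteq> y" "deg H x = 2" "deg H y = 2"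
  shows "set c \<inter> set d = {}"
proof (rule ccontr)
  assume ne: "set c \<inter> set d \<noteq> {}"
  have ycd: "y \<in> set d" "y \<notin> set c" "x \<in> set c" "x \<notin> set d" using c d xy by auto
  obtain t where t: "cyc F (y # t)" "set (y # t) = set d" "cedges (y # t) = cedges d"
    using cycle_start[OF d(1) ycd(1)] by metis
  have "\<exists>z\<in>set t. z \<in> set c" using ne ycd t(2) by auto
  then obtain N z r where N: "t = N @ z # r" "z \<in> set c" "\<forall>w\<in>set N. w \<notin> set c"
    using split_list_first_prop[of t "\<lambda>z. z \<in> set c"] by blast
  have dt: "distinct (y # t)" using t by (simp add: cyc_def)
  have zx: "z \<noteq> x" using N t(2) ycd by auto
  have NF: "edges (y # N @ [z]) \<subseteq> F"
    using t(1) N(1) cedges_split[of y N z r] by (auto simp: cyc_def)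
  obtain a b where ab: "distinct (x # a @ [z])" "distinct (x # b @ [z])"
    "set c = {x, z} \<union> set a \<union> set b" "length c = length a + length b + 2"
    "cedges c = edges (x # a @ [z]) \<union> edges (x # b @ [z])"
    using cycle_arcs[OF c(1) ycd(3) N(2)] zx by metis
  have cl: "6 * l < length c" using gap[OF c(1)] c(2) by simp
  have False if a: "distinct (x # a @ [z])" "set a \<subseteq> set c" "edges (x # a @ [z]) \<subseteq> cedges c" "l \<le> length a" for a
  proof -
    define Q where "Q = a @ z # rev N"
    have dQ: "distinct (x # Q @ [y])"
      using a(1,2) dt N ycd t(2) by (auto simp: Q_def)
    have QH: "set Q \<inter> \<Union>H = {}"
    proof -
      have "w \<notin> \<Union>H" if "w \<in> set Q" for w
      proof (cases "w \<in> set c")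
        case True
        then have "w \<noteq> x" using dQ that by auto
        then show ?thesis using c(3) True by blast
      next
        case False
        then have "w \<in> set N" using that a(2) N(2) by (auto simp: Q_def)
        then have "w \<in> set d" "w \<noteq> y" using N(1) t(2) dt by auto
        then show ?thesis using d(3) by blast
      qed
      then show ?thesis by blast
    qed
    have "edges (x # Q @ [y]) = edges (x # a @ [z]) \<union> edges (z # rev N @ [y])"
      using edges_append_mid[of "x # a" z "rev N @ [y]"] by (simp add: Q_def)
    then have QF: "edges (x # Q @ [y]) \<subseteq> F"
      using a(3) c(1) NF by (auto simp: cyc_def edges_rev_path)
    have "e \<notin> H" if "e \<in> edges (x # Q @ [y])" for e
      using edge_meets_interior[OF that] QH by (auto simp: Q_def)
    then have "edges (x # Q @ [y]) \<inter> H = {}" by blast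
    from ear[OF xy(2,3) dQ QH QF this] have "length Q + 2 < l" by auto
    then show False using a(4) by (simp add: Q_def)
  qed
  note * = this
  \<comment> \<open>The two arcs share more than 6l - 2 inner vertices, so one of them has at least
    l.\<close>
  have "l \<le> length a \<or> l \<le> length b" using ab(4) cl l3 by linarith
  then show False using *[of a] *[of b] ab by auto
qed

section \<open>Changes of class along \<open>H\<close> and along a long cycle\<close>

definition switching :: "'a \<Rightarrow> bool" where
  "switching v \<longleftrightarrow> deg H v = 2 \<and> (\<exists>e\<in>H. \<exists>f\<in>H. v \<in> e \<and> v \<in> f \<and> \<not> eqv e f)"

text \<open>The counterpart of \<open>switching\<close> for a cycle. Since \<open>switching\<close>
  refers to \<open>H\<close> alone, representatives can be chosen for deletion before any cycle is
  given.\<close>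

definition switches_at :: "'a list \<Rightarrow> 'a \<Rightarrow> bool" where
  "switches_at c v \<longleftrightarrow> v \<in> set c \<and> (\<exists>e\<in>cedges c. \<exists>f\<in>cedges c. v \<in> e \<and> v \<in> f \<and> \<not> eqv e f)"

text \<open>What is known of a long cycle that avoids the branch vertices and the single vertices of
  pendant cycles. Two vertices in \<open>H\<close> are what \<open>ear_through\<close> needs to cut
  the cycle into ears.\<close>

definition admissible :: "'a list \<Rightarrow> bool" where
  "admissible c \<longleftrightarrow> cyc F c \<and> l \<le> length c \<and> (\<forall>v\<in>set c \<inter> \<Union>H. deg H v = 2) \<and>
     (\<exists>u v. u \<in> set c \<and> v \<in> set c \<and> u \<noteq> v \<and> u \<in> \<Union>H \<and> v \<in> \<Union>H)"

text \<open>The two edges of \<open>H\<close> at \<open>v\<close> are the inequivalent pair, so each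
  class has at most one edge of \<open>H\<close> there.\<close>

lemma switching_edge_unique:
  assumes "switching v" "e \<in> H" "f \<in> H" "v \<in> e" "v \<in> f" "eqv e f"
  shows "e = f"
proof -
  obtain h g where hg: "h \<in> H" "g \<in> H" "v \<in> h" "v \<in> g" "\<not> eqv h g" using assms(1) by (auto simp: switching_def)
  then have "h \<noteq> g" by auto
  have "card {e \<in> H. v \<in> e} = 2" using assms(1) by (simp add: switching_def deg_def)
  then have "{h, g} = {e \<in> H. v \<in> e}"
    using hg \<open>h \<noteq> g\<close> finH by (intro card_subset_eq) auto
  then have "e \<in> {h, g}" "f \<in> {h, g}" using assms by auto
  then show ?thesis using hg(5) assms(6) eqv_sym by auto
qed

text \<open>Inside an ear both edges of the cycle at \<open>v\<close> would belong to that ear and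
  hence to one class. So \<open>v\<close> is an end of the ear through \<open>e\<close>, and the
  shadow of this ear in \<open>H\<close> provides \<open>h\<close>.\<close>

lemma switches_at_edge:
  assumes g: "admissible c" and v: "switches_at c v" and e: "e \<in> cedges c" "v \<in> e"
  shows "v \<in> \<Union>H \<and> (\<exists>h\<in>H. v \<in> h \<and> eqv e h)"
proof -
  have c: "cyc F c" using g by (simp add: admissible_def)
  obtain u w where uw: "u \<in> set c" "w \<in> set c" "u \<noteq> w" "u \<in> \<Union>H" "w \<in> \<Union>H" using g by (auto simp: admissible_def)
  obtain x y Q B where Q: "x \<in> \<Union>H" "y \<in> \<Union>H" "set Q \<inter> \<Union>H = {}" "distinct (x # Q @ y # B)"
    "e \<in> edges (x # Q @ [y])" "cedges c = edges (x # Q @ [y]) \<union> edges (y # B @ [x])"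
    "set c = set (x # Q @ y # B)"
    using ear_through[OF c e(1) uw] by metis
  have d: "distinct (x # Q @ [y])" using Q(4) by auto
  have F: "edges (x # Q @ [y]) \<subseteq> F" using Q(6) c by (auto simp: cyc_def)
  have "deg H x = 2" "deg H y = 2" using g Q(1,2,7) by (auto simp: admissible_def)
  from ear_eqv[OF this d Q(3) F] obtain R where R: "edges (x # R @ [y]) \<subseteq> H"
    "\<And>e f. e \<in> edges (x # Q @ [y]) \<union> edges (x # R @ [y]) \<Longrightarrow>
      f \<in> edges (x # Q @ [y]) \<union> edges (x # R @ [y]) \<Longrightarrow> eqv e f" by blast
  have "v \<notin> set Q"
  proof
    assume vQ: "v \<in> set Q"
    have "v \<in> set c" using v by (simp add: switches_at_def)
    then have "card {e \<in> edges (x # Q @ [y]). v \<in> e} = card {e \<in> cedges c. v \<in> e}"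
      using deg_cycle[OF c] deg_path_interior[OF d vQ] by (simp add: deg_def)
    then have "{e \<in> edges (x # Q @ [y]). v \<in> e} = {e \<in> cedges c. v \<in> e}"
      using Q(6) by (intro card_subset_eq) auto
    then show False using v R(2) by (auto simp: switches_at_def)
  qed
  moreover have "v \<in> set (x # Q @ [y])" using edges_subset[OF Q(5)] e(2) by blast
  ultimately have vxy: "v \<in> {x, y}" by auto
  have "\<Union>(edges (x # R @ [y])) = set (x # R @ [y])" by (rule Union_edges) simp
  then obtain h where "h \<in> edges (x # R @ [y])" "v \<in> h" using vxy by auto
  then show ?thesis using R Q(1,2,5) vxy by blast
qed

lemma switches_at_switching:
  assumes "admissible c" "switches_at c v"
  shows "switching v"
proof -
  obtain e f where ef: "e \<in> cedges c" "f \<in> cedges c" "v \<in> e" "v \<in> f" "\<not> eqv e f" and vc: "v \<in> set c"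
    using assms(2) by (auto simp: switches_at_def)
  obtain h where h: "h \<in> H" "v \<in> h" "eqv e h" "v \<in> \<Union>H" using switches_at_edge[OF assms ef(1,3)] by blast
  obtain g where g: "g \<in> H" "v \<in> g" "eqv f g" using switches_at_edge[OF assms ef(2,4)] by blast
  have "\<not> eqv h g" using ef(5) h(3) g(3) eqv_sym eqv_trans by blast
  then show ?thesis using h g assms(1) vc by (auto simp: switching_def admissible_def)
qed

text \<open>By \<open>class_short\<close> the cycle is not contained in the class of one of its
  edges, so a tour starting with that edge leaves the class at some vertex.\<close>

lemma admissible_switches:
  assumes g: "admissible c"
  shows "\<exists>v. switches_at c v"
proof -
  have c: "cyc F c" "l \<le> length c" using g by (auto simp: admissible_def)
  have "c \<noteq> []" using c(1) by (auto simp: cyc_def)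
  then have "cedges c \<noteq> {}" using Union_cedges[of c] by auto
  then obtain e where "e \<in> cedges c" by blast
  moreover then have "card e = 2" using c(1) two by (auto simp: cyc_def)
  ultimately obtain t s where "{t, s} \<in> cedges c" by (auto simp: card_2_iff)
  then obtain m where m: "distinct (t # s # m)" "cedges c = edges (t # s # m @ [t])"
    "set c = set (t # s # m)" using closed_walk_from[OF c(1)] by metis
  have "\<not> edges (t # s # m @ [t]) \<subseteq> {e. eqv {t, s} e}"
    using class_short[OF c(1), of "{t, s}"] c(2) m(2) by auto
  then obtain q u w r where q: "t # s # m @ [t] = q @ u # w # r" "q \<noteq> []"
    "eqv {t, s} {last q, u}" "\<not> eqv {t, s} {u, w}"
    using leave_class[of t s "{e. eqv {t, s} e}" "m @ [t]"] by auto
  have "edges (q @ u # w # r) = cedges c" using q(1) m(2) by simp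
  then have "{last q, u} \<in> cedges c" "{u, w} \<in> cedges c"
    using edges_append[of q "u # w # r"] q(2) by auto
  moreover have "u \<in> set c"
  proof -
    have "set c = set (t # s # m @ [t])" using m(3) by auto
    then show ?thesis unfolding q(1) by simp
  qed
  moreover have "\<not> eqv {last q, u} {u, w}" using q eqv_trans by blast
  ultimately show ?thesis unfolding switches_at_def by blast
qed

text \<open>The class of edges by which the cycle leaves \<open>x\<close> is carried by exactly one edge of \<open>H\<close> at
  \<open>x\<close>, and the path from \<open>x\<close> to \<open>v\<close> is a whole component of that class in \<open>H\<close>. By \<open>ear_eqv\<close> the
  cycle can be shadowed inside this component until it leaves the class, which can only happen at \<open>v\<close>.\<close>

lemma propagate_step:
  assumes g: "admissible c" and d: "distinct (x # N @ [v])" and H: "edges (x # N @ [v]) \<subseteq> H"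
    and d2: "\<forall>z\<in>set (x # N @ [v]). deg H z = 2" and x: "switches_at c x" and v: "switching v"
    and N: "\<forall>z\<in>set N. \<not> switching z"
  shows "switches_at c v"
proof -
  have c: "cyc F c" using g by (simp add: admissible_def)
  define b0 r0 where "b0 = hd (N @ [v])" and "r0 = tl (N @ [v])"
  define e0 where "e0 = {x, b0}"
  define D where "D = {e. eqv e0 e}"
  define Z where "Z = set (x # N @ [v])"
  have pe: "x # N @ [v] = x # b0 # r0" by (simp add: b0_def r0_def)
  have e0: "e0 \<in> H" "x \<in> e0" "e0 \<in> D" using H by (auto simp: pe e0_def D_def)
  have D_eqv: "eqv e f" if "e \<in> D" "f \<in> D" for e f
  proof -
    have "eqv e0 e" "eqv e0 f" using that by (simp_all add: D_def)
    then show ?thesis using eqv_trans[OF eqv_sym] by blast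
  qed
  have D_cl: "f \<in> D" if "e \<in> D" "eqv e f" for e f
    using that eqv_trans[of e0 e f] by (simp add: D_def)
  have inD: "edges (x # N @ [v]) \<subseteq> D"
  proof (rule ccontr)
    assume "\<not> edges (x # N @ [v]) \<subseteq> D"
    then obtain q u t r where q: "x # N @ [v] = q @ u # t # r" "q \<noteq> []" "{last q, u} \<in> D" "{u, t} \<notin> D"
      using leave_class[of x b0 D r0] e0(3) unfolding pe e0_def by blast
    have E: "{last q, u} \<in> H" "{u, t} \<in> H"
      using H unfolding q(1) using edges_append[of q "u # t # r"] q(2) by auto
    have "\<not> eqv {last q, u} {u, t}" using q(3,4) D_cl by blast
    moreover have "u \<in> set N"
    proof -
      obtain q' where "q = x # q'" using q(1,2) by (cases q) auto
      then have "N @ [v] = (q' @ [u]) @ (t # r)" using q(1) by simp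
      then have "N = butlast ((q' @ [u]) @ (t # r))" by (metis butlast_snoc)
      then show ?thesis by (simp add: butlast_append)
    qed
    moreover have "u \<in> {last q, u}" "u \<in> {u, t}" by auto
    moreover have "deg H u = 2" using \<open>u \<in> set N\<close> d2 by simp
    ultimately have "switching u" using E unfolding switching_def by blast
    then show False using N \<open>u \<in> set N\<close> by blast
  qed
  have swx: "switching x" by (rule switches_at_switching[OF g x])
  \<comment> \<open>An inner vertex has both its edges of \<open>H\<close> on the path. The ends are
    switching, so their edge on the path is their only edge of \<open>H\<close> in
    \<open>D\<close>.\<close>
  have closed: "b \<in> Z" if a: "a \<in> Z" and ab: "{a, b} \<in> H" "{a, b} \<in> D" for a b
  proof -
    have "{a, b} \<in> edges (x # N @ [v])"
    proof (cases "a \<in> set N")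
      case True
      have "card {e \<in> edges (x # N @ [v]). a \<in> e} = card {e \<in> H. a \<in> e}"
        using deg_path_interior[OF d True] d2 True by (simp add: deg_def)
      then have "{e \<in> edges (x # N @ [v]). a \<in> e} = {e \<in> H. a \<in> e}"
        using H finH by (intro card_subset_eq) auto
      then show ?thesis using ab by auto
    next
      case False
      then have "switching a" using a swx v by (auto simp: Z_def)
      have "\<Union>(edges (x # N @ [v])) = set (x # N @ [v])" by (rule Union_edges) simp
      then obtain h where h: "h \<in> edges (x # N @ [v])" "a \<in> h" using a by (auto simp: Z_def)
      then have "{a, b} = h"
        using switching_edge_unique[OF \<open>switching a\<close> ab(1), of h] H inD D_eqv[OF ab(2), of h] by auto
      then show ?thesis using h by simp
    qed
    then show ?thesis using edges_subset unfolding Z_def by blast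
  qed
  have walk: "hd p \<in> Z \<longrightarrow> set p \<subseteq> Z" if "edges p \<subseteq> H" "edges p \<subseteq> D" for p
    using that
  proof (induction p rule: edges.induct)
    case (1 y z r)
    then show ?case using closed[of y z] by auto
  qed auto
  \<comment> \<open>The two classes of the cycle at \<open>x\<close> are those of the two edges of
    \<open>H\<close> at \<open>x\<close>, one of which is the class \<open>D\<close> of
    \<open>e0\<close>. So the cycle has exactly one edge at \<open>x\<close> in \<open>D\<close>,
    and the tour below starts with it.\<close>
  obtain f f' where f: "f \<in> cedges c" "x \<in> f" "f \<in> D" "f' \<in> cedges c" "f' \<notin> D"
  proof -
    obtain e1 e2 where e: "e1 \<in> cedges c" "e2 \<in> cedges c" "x \<in> e1" "x \<in> e2" "\<not> eqv e1 e2"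
      using x by (auto simp: switches_at_def)
    obtain h1 where h1: "h1 \<in> H" "x \<in> h1" "eqv e1 h1" using switches_at_edge[OF g x e(1,3)] by blast
    obtain h2 where h2: "h2 \<in> H" "x \<in> h2" "eqv e2 h2" using switches_at_edge[OF g x e(2,4)] by blast
    have "\<not> eqv h1 h2" using e(5) h1(3) h2(3) eqv_sym eqv_trans by blast
    then have "h1 \<noteq> h2" by auto
    have "card {e \<in> H. x \<in> e} = 2" using swx by (simp add: switching_def deg_def)
    then have "{h1, h2} = {e \<in> H. x \<in> e}"
      using h1 h2 \<open>h1 \<noteq> h2\<close> finH by (intro card_subset_eq) auto
    then have "e0 = h1 \<or> e0 = h2" using e0 by auto
    then have "e1 \<in> D \<or> e2 \<in> D"
      using eqv_sym[OF h1(3)] eqv_sym[OF h2(3)] by (auto simp: D_def)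
    moreover have "\<not> (e1 \<in> D \<and> e2 \<in> D)" using e(5) D_eqv by blast
    ultimately show ?thesis using that e by metis
  qed
  have "card f = 2" using f(1) c two by (auto simp: cyc_def)
  then obtain b where b: "f = {x, b}" using f(2) by (auto simp: card_2_iff insert_commute)
  obtain m where m: "distinct (x # b # m)" "cedges c = edges (x # b # m @ [x])" "set c = set (x # b # m)"
    using closed_walk_from[OF c] f(1) b by metis
  have "\<not> edges (x # b # m @ [x]) \<subseteq> D" using f m(2) by auto
  then obtain q u t r where q: "x # b # m @ [x] = q @ u # t # r" "q \<noteq> []" "edges (q @ [u]) \<subseteq> D"
    "{last q, u} \<in> D" "{u, t} \<notin> D"
    using leave_class[of x b D "m @ [x]"] f(3) b by blast
  have cq: "cedges c = edges (q @ u # t # r)" using m(2) q(1) by simp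
  have pre: "x # b # m = (q @ [u]) @ butlast (t # r)"
  proof -
    have "x # b # m = butlast (x # b # m @ [x])" by (simp add: butlast_append)
    also have "\<dots> = (q @ [u]) @ butlast (t # r)" unfolding q(1) by (simp add: butlast_append)
    finally show ?thesis .
  qed
  have dq: "distinct (q @ [u])" and sq: "set (q @ [u]) \<subseteq> set c"
    using m(1,3) unfolding pre by auto
  have hq: "hd (q @ [u]) = x" using pre q(2) by (metis append_is_Nil_conv hd_append2 list.sel(1) not_Cons_self2)
  have ce: "{last q, u} \<in> cedges c" "{u, t} \<in> cedges c" "edges (q @ [u]) \<subseteq> cedges c"
    unfolding cq using edges_append[of q "u # t # r"] edges_append[of q "[u]"] q(2) by auto
  have "\<not> eqv {last q, u} {u, t}" using q(4,5) D_cl by blast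
  moreover have "u \<in> {last q, u}" "u \<in> {u, t}" "u \<in> set c" using sq by auto
  ultimately have swu: "switches_at c u" using ce unfolding switches_at_def by blast
  then have "switching u" using switches_at_switching[OF g] by blast
  then have uH: "u \<in> \<Union>H" by (intro deg2_in) (simp add: switching_def)
  have xH: "x \<in> \<Union>H" using swx by (intro deg2_in) (simp add: switching_def)
  \<comment> \<open>Each ear of the tour inside \<open>D\<close> is replaced by its shadow, a walk
    in \<open>H\<close> inside \<open>D\<close>, and such walks never leave
    \<open>Z\<close>.\<close>
  have "hd p \<in> Z \<longrightarrow> last p \<in> Z"
    if "p \<noteq> []" "hd p \<in> \<Union>H" "last p \<in> \<Union>H" "distinct p" "set p \<subseteq> set c" "edges p \<subseteq> D" "edges p \<subseteq> F" for p
    using that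
  proof (induction rule: path_induct)
    case (step y M w r)
    have sp: "edges (y # M @ w # r) = edges (y # M @ [w]) \<union> edges (w # r)"
      using edges_append_mid[of "y # M" w r] by simp
    have "deg H y = 2" "deg H w = 2" using g step by (auto simp: admissible_def)
    moreover have "distinct (y # M @ [w])" "edges (y # M @ [w]) \<subseteq> F" "edges (y # M @ [w]) \<subseteq> D"
      using step sp by auto
    ultimately obtain R where R: "edges (y # R @ [w]) \<subseteq> H"
      "\<And>e f. e \<in> edges (y # M @ [w]) \<Longrightarrow> f \<in> edges (y # R @ [w]) \<Longrightarrow> eqv e f"
      using ear_eqv[of y w M] step(3) by blast
    have "{y, hd (M @ [w])} \<in> edges (y # M @ [w])" by (simp add: edges_Cons)
    then have "edges (y # R @ [w]) \<subseteq> D"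
      using R(2) \<open>edges (y # M @ [w]) \<subseteq> D\<close> D_cl by blast
    then have "y \<in> Z \<longrightarrow> w \<in> Z" using walk[OF R(1)] by auto
    then show ?case using step sp by auto
  qed auto
  from this[of "q @ [u]"] have "u \<in> Z"
    using hq dq sq q(3) ce(3) xH uH c by (auto simp: Z_def cyc_def)
  moreover have "u \<noteq> x" using hq dq q(2) by (cases q) auto
  ultimately have "u = v" using \<open>switching u\<close> N by (auto simp: Z_def)
  then show ?thesis using swu by simp
qed

text \<open>Cut the path of \<open>H\<close> at its switching vertices and pass from each of them to
  the next.\<close>

lemma propagate:
  assumes "p \<noteq> []" "switching (hd p)" "switching (last p)" "distinct p" "edges p \<subseteq> H" "\<forall>z\<in>set p. deg H z = 2"
    "admissible c" "switches_at c (hd p)"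
  shows "switches_at c (last p)"
proof -
  have "p \<noteq> []" "hd p \<in> {v. switching v}" "last p \<in> {v. switching v}" using assms by auto
  then show ?thesis using assms(4,5,6,8)
  proof (induction rule: path_induct)
    case (step x N v r)
    have sp: "edges (x # N @ v # r) = edges (x # N @ [v]) \<union> edges (v # r)"
      using edges_append_mid[of "x # N" v r] by simp
    have "switches_at c v"
      by (rule propagate_step[OF assms(7), of x N v]) (use step sp in auto)
    then show ?case using step sp by auto
  qed auto
qed

end

subsection \<open>The hitting set\<close>

context skeleton
begin

definition conn :: "('a \<times> 'a) set" where
  "conn = {(a, b). {a, b} \<in> H \<and> deg H a = 2 \<and> deg H b = 2}"

definition component :: "'a \<Rightarrow> 'a set" where
  "component v = {w. (v, w) \<in> conn\<^sup>*}"

definition components :: "'a set set" where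
  "components = component ` {v. deg H v = 2}"

text \<open>Edges are counted rather than branch vertices, since a component may be attached twice
  to the same branch vertex.\<close>

definition boundary :: "'a set \<Rightarrow> 'a set set" where
  "boundary K = {e \<in> H. card (e \<inter> K) = 1}"

definition branch :: "'a set" where
  "branch = {v. deg H v = 3}"

lemma conn_path:
  assumes "(v, w) \<in> conn\<^sup>*" "deg H v = 2"
  shows "\<exists>p. p \<noteq> [] \<and> hd p = v \<and> last p = w \<and> distinct p \<and> edges p \<subseteq> H \<and> (\<forall>z\<in>set p. deg H z = 2)"
  using assms(1)
proof (induction rule: rtrancl_induct)
  case base
  then show ?case using assms(2) by (intro exI[of _ "[v]"]) simp
next
  case (step y z)
  then obtain p where p: "p \<noteq> []" "hd p = v" "last p = y" "distinct p" "edges p \<subseteq> H"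
    "\<forall>z\<in>set p. deg H z = 2" by blast
  have z: "{y, z} \<in> H" "deg H z = 2" using step(2) by (auto simp: conn_def)
  show ?case
  proof (cases "z \<in> set p")
    case True
    then obtain A B where "p = A @ z # B" by (meson split_list)
    then show ?thesis using p edges_append_mid[of A z B]
      by (intro exI[of _ "A @ [z]"]) (auto simp: hd_append)
  next
    case False
    then show ?thesis using p z
      by (intro exI[of _ "p @ [z]"]) (auto simp: edges_append)
  qed
qed

lemma component_eq: "w \<in> component v \<Longrightarrow> component w = component v"
proof -
  assume "w \<in> component v"
  then have vw: "(v, w) \<in> conn\<^sup>*" by (simp add: component_def)
  have "sym conn" by (auto simp: sym_def conn_def insert_commute)
  then have "sym (conn\<^sup>*)" by (rule sym_rtrancl)
  then have wv: "(w, v) \<in> conn\<^sup>*" using vw by (rule symD)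
  show ?thesis
    unfolding component_def using rtrancl_trans[OF vw] rtrancl_trans[OF wv] by blast
qed

lemma component_deg:
  assumes "deg H v = 2" "w \<in> component v"
  shows "deg H w = 2"
proof -
  have "(v, w) \<in> conn\<^sup>*" using assms(2) by (simp add: component_def)
  then show ?thesis
  proof (cases rule: rtranclE)
    case (step y)
    then show ?thesis unfolding conn_def by blast
  qed (use assms(1) in simp)
qed

lemma components_eq: "K \<in> components \<Longrightarrow> K' \<in> components \<Longrightarrow> v \<in> K \<Longrightarrow> v \<in> K' \<Longrightarrow> K = K'"
  unfolding components_def using component_eq by blast

lemma components_deg: "K \<in> components \<Longrightarrow> v \<in> K \<Longrightarrow> deg H v = 2"
  using component_deg by (auto simp: components_def)

lemma components_closed:
  assumes "K \<in> components" "{a, b} \<in> H" "a \<in> K" "b \<notin> K"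
  shows "deg H b = 3"
proof -
  have "deg H b \<noteq> 2"
  proof
    assume "deg H b = 2"
    then have "(a, b) \<in> conn" using assms components_deg by (auto simp: conn_def)
    then have "b \<in> component a" by (auto simp: component_def)
    moreover have "component a = K" using assms(1,3) component_eq by (auto simp: components_def)
    ultimately show False using assms(4) by simp
  qed
  moreover have "b \<in> \<Union>H" using assms(2) by blast
  ultimately show ?thesis using degH by blast
qed

lemma finite_VH: "finite (\<Union>H)" "finite branch" "branch \<subseteq> \<Union>H"
  using branch_vertices_finite[OF finH twoH] by (auto simp: branch_def)

lemma finite_components: "finite components" "K \<in> components \<Longrightarrow> finite K"
proof -
  have "{v. deg H v = 2} \<subseteq> \<Union>H" using deg2_in by blast
  then have f: "finite {v. deg H v = 2}" using finite_VH(1) finite_subset by blast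
  then show "finite components" by (simp add: components_def)
  show "finite K" if "K \<in> components"
    by (rule finite_subset[OF _ f]) (use components_deg[OF that] in auto)
qed

text \<open>The degrees in \<open>K\<close> add up to 2|K|, and edges inside \<open>K\<close>
  contribute two each. Hence a component with an edge to a branch vertex has at least two such
  edges.\<close>

lemma boundary_even:
  assumes K: "K \<in> components"
  shows "even (card (boundary K))"
proof -
  have fK: "finite K" by (rule finite_components(2)[OF K])
  define I where "I = {e \<in> H. e \<subseteq> K}"
  have "2 * card K = (\<Sum>v\<in>K. deg H v)" using components_deg[OF K] by simp
  also have "\<dots> = (\<Sum>e\<in>H. card (e \<inter> K))" by (rule handshake[OF finH fK])
  also have "\<dots> = (\<Sum>e\<in>H. (if e \<in> boundary K then 1 else 0) + 2 * (if e \<in> I then 1 else 0))"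
  proof (rule sum.cong)
    fix e assume e: "e \<in> H"
    then have e2: "card e = 2" using twoH by blast
    then have fe: "finite e" by (metis card.infinite zero_neq_numeral)
    have le: "card (e \<inter> K) \<le> 2" using card_mono[OF fe, of "e \<inter> K"] e2 by simp
    show "card (e \<inter> K) = (if e \<in> boundary K then 1 else 0) + 2 * (if e \<in> I then 1 else 0)"
    proof (cases "e \<subseteq> K")
      case True
      then have "e \<inter> K = e" by blast
      then show ?thesis using e e2 True by (simp add: boundary_def I_def)
    next
      case False
      then have "e \<inter> K \<subset> e" by blast
      then have "card (e \<inter> K) < 2" using psubset_card_mono[OF fe] e2 by metis
      then show ?thesis using e False by (auto simp: boundary_def I_def)
    qed
  qed simp
  also have "\<dots> = card (boundary K) + 2 * card I"
  proof -
    have "H \<inter> {e. e \<in> boundary K} = boundary K" "H \<inter> {e. e \<in> I} = I" by (auto simp: boundary_def I_def)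
    then show ?thesis using finH
      by (simp add: sum.distrib sum.If_cases flip: sum_distrib_left)
  qed
  finally show ?thesis by presburger
qed

text \<open>Every such component owns at least two boundary edges, no edge is owned twice, and each
  has an end among the branch vertices, which offer only three edge ends apiece.\<close>

lemma open_components: "2 * card {K \<in> components. boundary K \<noteq> {}} \<le> 3 * card branch"
proof -
  define Op where "Op = {K \<in> components. boundary K \<noteq> {}}"
  have finOp: "finite Op" using finite_components by (simp add: Op_def)
  have finb: "finite (boundary K)" for K using finH by (simp add: boundary_def)
  have edge: "\<exists>a b. e = {a, b} \<and> a \<in> K \<and> deg H a = 2 \<and> deg H b = 3"
    if K: "K \<in> components" and e: "e \<in> boundary K" for K e
  proof -
    have eH: "e \<in> H" "card (e \<inter> K) = 1" using e by (auto simp: boundary_def)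
    then obtain a where a: "e \<inter> K = {a}" by (auto simp: card_1_singleton_iff)
    obtain b where b: "e = {a, b}" "a \<noteq> b"
    proof -
      obtain u w where "e = {u, w}" "u \<noteq> w" using eH(1) twoH by (auto simp: card_2_iff)
      moreover have "a \<in> e" using a by blast
      ultimately show ?thesis using that by (metis insert_commute insert_iff singletonD)
    qed
    have "b \<notin> K" using a b by auto
    moreover have "a \<in> K" using a by blast
    ultimately show ?thesis using components_closed[OF K, of a b] components_deg[OF K, of a] eH(1) b by auto
  qed
  have "2 * card Op = (\<Sum>K\<in>Op. 2)" by simp
  also have "\<dots> \<le> (\<Sum>K\<in>Op. card (boundary K))"
  proof (rule sum_mono)
    fix K assume K: "K \<in> Op"
    then have "even (card (boundary K))" "card (boundary K) \<noteq> 0"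
      using boundary_even finb[of K] by (auto simp: Op_def)
    then show "2 \<le> card (boundary K)" by presburger
  qed
  also have "\<dots> = card (\<Union>K\<in>Op. boundary K)"
  proof (rule card_UN_disjoint[symmetric])
    show "\<forall>K\<in>Op. \<forall>K'\<in>Op. K \<noteq> K' \<longrightarrow> boundary K \<inter> boundary K' = {}"
    proof (intro ballI impI equals0I)
      fix K K' e assume K: "K \<in> Op" "K' \<in> Op" "K \<noteq> K'" and e: "e \<in> boundary K \<inter> boundary K'"
      obtain a b where ab: "e = {a, b}" "a \<in> K" "deg H a = 2" "deg H b = 3"
        using edge[of K e] K e by (auto simp: Op_def)
      obtain a' b' where ab': "e = {a', b'}" "a' \<in> K'" "deg H a' = 2" "deg H b' = 3"
        using edge[of K' e] K e by (auto simp: Op_def)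
      have "a' = a" using ab ab' by (auto simp: doubleton_eq_iff)
      then show False using components_eq[of K K' a] K ab ab' by (auto simp: Op_def)
    qed
  qed (use finOp finb in auto)
  also have "\<dots> \<le> card {e \<in> H. e \<inter> branch \<noteq> {}}"
  proof (rule card_mono)
    show "(\<Union>K\<in>Op. boundary K) \<subseteq> {e \<in> H. e \<inter> branch \<noteq> {}}"
    proof
      fix e assume "e \<in> (\<Union>K\<in>Op. boundary K)"
      then obtain K where K: "K \<in> components" "e \<in> boundary K" by (auto simp: Op_def)
      then show "e \<in> {e \<in> H. e \<inter> branch \<noteq> {}}"
        using edge[OF K] by (auto simp: boundary_def branch_def)
    qed
  qed (use finH in simp)
  also have "\<dots> = (\<Sum>e\<in>{e \<in> H. e \<inter> branch \<noteq> {}}. 1)" by simp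
  also have "\<dots> \<le> (\<Sum>e\<in>{e \<in> H. e \<inter> branch \<noteq> {}}. card (e \<inter> branch))"
    by (rule sum_mono) (use finite_VH(2) in \<open>auto simp: Suc_le_eq card_gt_0_iff\<close>)
  also have "\<dots> \<le> (\<Sum>e\<in>H. card (e \<inter> branch))"
    by (rule sum_mono2) (use finH in auto)
  also have "\<dots> = (\<Sum>v\<in>branch. deg H v)" using handshake[OF finH finite_VH(2)] by simp
  also have "\<dots> = 3 * card branch" by (simp add: branch_def)
  finally show ?thesis by (simp add: Op_def)
qed

text \<open>The edges of \<open>H\<close> inside \<open>K\<close> form a graph with all degrees two,
  so \<open>short_branch_cycle\<close> applies with \<open>r = 1\<close>.\<close>

lemma closed_component_cycle:
  assumes K: "K \<in> components" "boundary K = {}"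
  shows "\<exists>c. cyc H c \<and> set c \<subseteq> K"
proof -
  define HK where "HK = {e \<in> H. e \<subseteq> K}"
  have deg: "deg HK v = 2" if v: "v \<in> K" for v
  proof -
    have "e \<subseteq> K" if e: "e \<in> H" "v \<in> e" for e
    proof -
      have e2: "card e = 2" using twoH e by blast
      then obtain b where b: "e = {v, b}" using e(2) by (auto simp: card_2_iff insert_commute)
      show ?thesis
      proof (rule ccontr)
        assume "\<not> e \<subseteq> K"
        then have "e \<inter> K = {v}" using b v by auto
        then have "e \<in> boundary K" using e by (simp add: boundary_def)
        then show False using K by simp
      qed
    qed
    then have "{e \<in> HK. v \<in> e} = {e \<in> H. v \<in> e}" by (auto simp: HK_def)
    then show ?thesis using components_deg[OF K(1) v] by (simp add: deg_def)
  qed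
  have sub: "\<Union>HK \<subseteq> K" by (auto simp: HK_def)
  have deg0: "deg HK v = 0" if "v \<notin> K" for v
    using that sub by (intro deg_0) blast
  have "deg HK v \<noteq> 3" for v using deg[of v] deg0[of v] by (cases "v \<in> K") auto
  then have "card {v. deg HK v = 3} < 2 ^ 1" by simp
  moreover obtain v where "v \<in> K" using K(1) by (auto simp: components_def component_def)
  then have "HK \<noteq> {}" using deg[of v] by (auto simp: deg_def)
  moreover have "\<forall>v\<in>\<Union>HK. deg HK v = 2 \<or> deg HK v = 3" using deg sub by blast
  moreover have "finite HK" "\<forall>e\<in>HK. card e = 2" using finH twoH by (auto simp: HK_def)
  ultimately obtain c where c: "cyc HK c" using short_branch_cycle[of HK 1] by blast
  then have "c \<noteq> []" "cedges c \<subseteq> HK" by (auto simp: cyc_def)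
  then have "set c \<subseteq> K" using Union_cedges[of c] sub by blast
  moreover have "cyc H c" using cyc_mono[OF c] by (auto simp: HK_def)
  ultimately show ?thesis by blast
qed

text \<open>As all degrees are two or three, the number of branch vertices is twice the excess of
  edges over vertices. A larger number would give \<open>k\<close> disjoint cycles in
  \<open>H\<close> by \<open>excess_packing\<close>, and cycles of \<open>H\<close> are
  long.\<close>

lemma branch_bound:
  assumes "\<not> packing F l k" "1 \<le> k" "1 \<le> r" "card branch < 2 ^ r"
  shows "card branch \<le> 4 * r * (k - 1) + 1"
proof (rule ccontr)
  assume neg: "\<not> ?thesis"
  have "2 * card H = (\<Sum>e\<in>H. card (e \<inter> \<Union>H))"
  proof -
    have "card (e \<inter> \<Union>H) = 2" if "e \<in> H" for e
    proof -
      have "e \<inter> \<Union>H = e" using that by blast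
      then show ?thesis using twoH that by simp
    qed
    then show ?thesis by simp
  qed
  also have "\<dots> = (\<Sum>v\<in>\<Union>H. deg H v)" using handshake[OF finH finite_VH(1)] by simp
  also have "\<dots> = (\<Sum>v\<in>\<Union>H. 2 + (if v \<in> branch then 1 else 0))"
  proof (rule sum.cong)
    fix v assume "v \<in> \<Union>H"
    then have "deg H v = 2 \<or> deg H v = 3" by (rule degH)
    then show "deg H v = 2 + (if v \<in> branch then 1 else 0)" by (auto simp: branch_def)
  qed simp
  also have "\<dots> = 2 * card (\<Union>H) + card branch"
  proof -
    have "\<Union>H \<inter> {v. v \<in> branch} = branch" using finite_VH(3) by blast
    then have "(\<Sum>v\<in>\<Union>H. if v \<in> branch then 1 else 0) = card branch"
      using finite_VH(1) by (simp add: sum.If_cases)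
    then show ?thesis unfolding sum.distrib by simp
  qed
  finally have "card (\<Union>H) + 2 * r * (k - 1) + 1 \<le> card H" using neg by simp
  moreover have "\<forall>v. deg H v \<le> 3"
  proof
    fix v show "deg H v \<le> 3" using degH[of v] deg_0[of v H] by (cases "v \<in> \<Union>H") auto
  qed
  ultimately have "packing H 0 (Suc (k - 1))"
    using excess_packing[OF finH twoH] assms(3,4) by (simp add: branch_def)
  then obtain Cs where "length Cs = k" "\<forall>c\<in>set Cs. cyc H c" "sorted_wrt (\<lambda>c d. set c \<inter> set d = {}) Cs"
    using assms(2) by (auto simp: packing_def)
  then have "packing F l k"
    unfolding packing_def using longH cyc_mono[OF _ HF] by (intro exI[of _ Cs]) simp
  then show False using assms(1) by simp
qed

text \<open>With b branch vertices the count is b + (k-1) for pendant vertices, plus at most (k-1) +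
  3b/2 for the components: those without boundary contain disjoint long cycles. The bound is doubled
  to avoid fractions.\<close>

lemma hitting_set:
  assumes np: "\<not> packing F l k"
  shows "\<exists>X\<subseteq>\<Union>F. 2 * card X \<le> 5 * card branch + 4 * (k - 1) \<and>
    \<not> (\<exists>c. cyc F c \<and> l \<le> length c \<and> set c \<inter> X = {})"
proof -
  define pend where "pend x c \<longleftrightarrow> cyc F c \<and> l \<le> length c \<and> set c \<inter> \<Union>H = {x}" for x c
  define X1 where "X1 = {x. deg H x = 2 \<and> (\<exists>c. pend x c)}"
  define rep where "rep K = (SOME z. z \<in> K \<and> switching z)" for K
  define SK where "SK = {K \<in> components. \<exists>z\<in>K. switching z}"
  define X where "X = branch \<union> X1 \<union> rep ` SK"
  have rep: "rep K \<in> K" "switching (rep K)" if "K \<in> SK" for K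
    using someI_ex[of "\<lambda>z. z \<in> K \<and> switching z"] that by (auto simp: rep_def SK_def)
  have X1H: "X1 \<subseteq> \<Union>H" using deg2_in by (auto simp: X1_def)
  have finX1: "finite X1" by (rule finite_subset[OF X1H finite_VH(1)])
  have "card X1 < k"
  proof (rule ccontr)
    assume nk: "\<not> card X1 < k"
    define C where "C x = (SOME c. pend x c)" for x
    have C: "pend x (C x)" if "x \<in> X1" for x
      using someI_ex[of "pend x"] that by (auto simp: C_def X1_def)
    have "packing F l k"
    proof (rule packing_index[OF finX1, of k F C l])
      show "set (C x) \<inter> set (C y) = {}" if "x \<in> X1" "y \<in> X1" "x \<noteq> y" for x y
        by (rule pendant_disjoint[of "C x" x "C y" y])
          (use C[OF that(1)] C[OF that(2)] that in \<open>simp_all add: pend_def X1_def\<close>)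
    qed (use nk C in \<open>auto simp: pend_def\<close>)
    then show False using np by simp
  qed
  moreover have "card {K \<in> components. boundary K = {}} < k"
  proof (rule ccontr)
    assume nk: "\<not> ?thesis"
    define C where "C K = (SOME c. cyc H c \<and> set c \<subseteq> K)" for K
    have C: "cyc H (C K) \<and> set (C K) \<subseteq> K" if "K \<in> components" "boundary K = {}" for K
      unfolding C_def by (rule someI_ex) (rule closed_component_cycle[OF that])
    have "packing F l k"
    proof (rule packing_index)
      show "finite {K \<in> components. boundary K = {}}" using finite_components(1) by simp
      show "k \<le> card {K \<in> components. boundary K = {}}" using nk by simp
      show "cyc F (C K) \<and> l \<le> length (C K)" if "K \<in> {K \<in> components. boundary K = {}}" for K
        using C[of K] that cyc_mono[of H "C K", OF _ HF] longH[of "C K"] by simp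
      show "set (C K) \<inter> set (C K') = {}" if "K \<in> {K \<in> components. boundary K = {}}"
        "K' \<in> {K \<in> components. boundary K = {}}" "K \<noteq> K'" for K K'
        using C[of K] C[of K'] components_eq[of K K'] that by blast
    qed
    then show False using np by simp
  qed
  moreover have "card components = card {K \<in> components. boundary K = {}} + card {K \<in> components. boundary K \<noteq> {}}"
  proof -
    have "components = {K \<in> components. boundary K = {}} \<union> {K \<in> components. boundary K \<noteq> {}}" (is "_ = ?A \<union> ?B")
      by blast
    moreover have "card (?A \<union> ?B) = card ?A + card ?B"
      by (rule card_Un_disjoint) (use finite_components(1) in auto)
    ultimately show ?thesis by simp
  qed
  moreover have "card (rep ` SK) \<le> card components"
  proof -
    have "card (rep ` SK) \<le> card SK" by (rule card_image_le) (use finite_components(1) in \<open>simp add: SK_def\<close>)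
    also have "\<dots> \<le> card components" by (rule card_mono) (use finite_components(1) in \<open>auto simp: SK_def\<close>)
    finally show ?thesis .
  qed
  moreover have "card X \<le> card branch + card X1 + card (rep ` SK)"
    unfolding X_def using card_Un_le[of "branch \<union> X1" "rep ` SK"] card_Un_le[of branch X1] by linarith
  ultimately have "2 * card X \<le> 5 * card branch + 4 * (k - 1)"
    using open_components by linarith
  moreover have "X \<subseteq> \<Union>F"
  proof -
    have "rep ` SK \<subseteq> \<Union>H" using rep(2) deg2_in by (auto simp: switching_def)
    then have "X \<subseteq> \<Union>H" using X1H finite_VH(3) by (auto simp: X_def)
    then show ?thesis using HF by blast
  qed
  moreover have False if c: "cyc F c" "l \<le> length c" "set c \<inter> X = {}" for c
  proof -
    have deg2: "deg H v = 2" if "v \<in> set c \<inter> \<Union>H" for v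
    proof -
      have "v \<notin> branch" using that c(3) by (auto simp: X_def)
      then show ?thesis using degH[of v] that by (auto simp: branch_def)
    qed
    obtain x where x: "x \<in> set c \<inter> \<Union>H" using long_cycle_meets[OF c(1,2)] by blast
    have "set c \<inter> \<Union>H \<noteq> {x}"
    proof
      assume "set c \<inter> \<Union>H = {x}"
      then have "x \<in> X1" using c deg2[OF x] by (auto simp: X1_def pend_def)
      then show False using x c(3) by (auto simp: X_def)
    qed
    then obtain y where "y \<in> set c \<inter> \<Union>H" "y \<noteq> x" using x by blast
    then have g: "admissible c" using c deg2 x by (auto simp: admissible_def)
    then obtain v where v: "switches_at c v" using admissible_switches by blast
    then have sv: "switching v" by (rule switches_at_switching[OF g])
    then have dv: "deg H v = 2" by (simp add: switching_def)
    have vK: "v \<in> component v" by (simp add: component_def)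
    then have K: "component v \<in> SK" using sv dv by (auto simp: SK_def components_def)
    define z where "z = rep (component v)"
    have z: "z \<in> component v" "switching z" using rep[OF K] by (auto simp: z_def)
    then obtain p where p: "p \<noteq> []" "hd p = v" "last p = z" "distinct p" "edges p \<subseteq> H"
      "\<forall>z\<in>set p. deg H z = 2" using conn_path[OF _ dv, of z] by (auto simp: component_def)
    have "switches_at c (last p)" by (rule propagate) (use p z sv g v in auto)
    then have "z \<in> set c" using p by (simp add: switches_at_def)
    moreover have "z \<in> X" using K by (auto simp: X_def z_def)
    ultimately show False using c(3) by blast
  qed
  ultimately show ?thesis by blast
qed

end

text \<open>A maximal \<open>H\<close> exists because the empty edge set qualifies. Its number of
  branch vertices is exported as \<open>n\<close>, leaving only arithmetic.\<close>

lemma (in gap_graph) gap_hitting_set: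
  assumes "\<not> packing F l k" "1 \<le> k"
  shows "\<exists>n X. X \<subseteq> \<Union>F \<and> 2 * card X \<le> 5 * n + 4 * (k - 1) \<and>
    (\<forall>r\<ge>1. n < 2 ^ r \<longrightarrow> n \<le> 4 * r * (k - 1) + 1) \<and>
    \<not> (\<exists>c. cyc F c \<and> l \<le> length c \<and> set c \<inter> X = {})"
proof -
  define P where "P H \<longleftrightarrow> H \<subseteq> F \<and> (\<forall>v\<in>\<Union>H. deg H v = 2 \<or> deg H v = 3) \<and>
    (\<forall>c. cyc H c \<longrightarrow> l \<le> length c)" for H
  have "\<not> cyc {} c" for c :: "'a list"
    using path_acyclic[of "[]" c] by simp
  then have "P {}" by (simp add: P_def)
  moreover have "\<forall>H. P H \<longrightarrow> card H < Suc (card F)"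
    using card_mono[OF finF] unfolding P_def less_Suc_eq_le by blast
  ultimately have "\<exists>H. P H \<and> (\<forall>H'. P H' \<longrightarrow> card H' \<le> card H)"
    by (rule ex_has_greatest_nat)
  then obtain H where "P H \<and> (\<forall>H'. P H' \<longrightarrow> card H' \<le> card H)" ..
  then have H: "P H" "\<And>H'. P H' \<Longrightarrow> card H' \<le> card H" by simp_all
  interpret skeleton F l H
  proof unfold_locales
    show "H \<subseteq> F" using H(1) by (simp add: P_def)
    show "deg H v = 2 \<or> deg H v = 3" if "v \<in> \<Union>H" for v using H(1) that unfolding P_def by blast
    show "l \<le> length c" if "cyc H c" for c using H(1) that unfolding P_def by blast
    show "card H' \<le> card H" if "H' \<subseteq> F" "\<And>v. v \<in> \<Union>H' \<Longrightarrow> deg H' v = 2 \<or> deg H' v = 3"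
      "\<And>c. cyc H' c \<Longrightarrow> l \<le> length c" for H'
      by (rule H(2)) (use that in \<open>simp add: P_def\<close>)
  qed
  obtain X where "X \<subseteq> \<Union>F" "2 * card X \<le> 5 * card branch + 4 * (k - 1)"
    "\<not> (\<exists>c. cyc F c \<and> l \<le> length c \<and> set c \<inter> X = {})"
    using hitting_set[OF assms(1)] by (elim exE conjE) (rule that)
  then show ?thesis
    using branch_bound[OF assms] by (intro exI[of _ "card branch"] exI[of _ X]) simp
qed

subsection \<open>Numerical estimates\<close>

text \<open>From ln x \<le> x - 1 and ln 2 \<ge> 1/2, the latter because e \<le> 4.\<close>

lemma log2_le:
  assumes "1 \<le> (x :: real)"
  shows "log 2 x \<le> 2 * (x - 1)"
proof -
  have "(1 :: real) = ln (exp 1)" by simp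
  also have "\<dots> \<le> ln 4"
    using exp_le by (subst ln_le_cancel_iff) auto
  also have "\<dots> = 2 * ln 2"
    using ln_realpow[of "2 :: real" 2] by simp
  finally have l: "1 / 2 \<le> ln (2 :: real)" by simp
  have "ln x \<le> x - 1" using assms ln_le_minus_one[of x] by linarith
  also have "\<dots> \<le> (x - 1) * (2 * ln 2)" using l assms mult_left_mono[of 1 "2 * ln 2" "x - 1"] by simp
  finally have "ln x \<le> 2 * (x - 1) * ln 2" by (simp add: algebra_simps)
  then show ?thesis using l by (simp add: log_def pos_divide_le_eq)
qed

text \<open>Write n = N t with N the claimed bound 4ky, and suppose t > 1. Then r \<le> 1 + log n =
  3 + x + log y + log t. As log y \<le> 5/2 + log x, the constant 11/2 = 3 + 5/2 in y absorbs
  everything but log t. This yields r \<le> y t, which contradicts n \<le> 4r(k-1) + 1.\<close>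

lemma branch_estimate:
  fixes n k r :: nat
  assumes k: "3 \<le> k" and r: "2 ^ (r - 1) \<le> n" "1 \<le> r" and n: "n \<le> 4 * r * (k - 1) + 1"
  shows "real n \<le> 4 * real k * (log 2 (real k) + log 2 (log 2 (real k)) + 11 / 2)"
proof (rule ccontr)
  define x where "x = log 2 (real k)"
  define y where "y = x + log 2 x + 11 / 2"
  define N where "N = 4 * real k * y"
  define t where "t = real n / N"
  assume "\<not> ?thesis"
  then have nN: "N < real n" by (simp add: N_def y_def x_def)
  \<comment> \<open>Uses k \<ge> 3 in the form 2^3 \<le> 3^2.\<close>
  have x: "3 / 2 \<le> x"
  proof -
    have "(3 / 2 :: real) = log 2 (2 powr (3 / 2))" by simp
    also have "\<dots> \<le> log 2 (real k)"
    proof (subst log_le_cancel_iff)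
      have "(2 powr (3 / 2 :: real)) ^ 2 = 2 powr (3 / 2 + 3 / 2)"
        by (simp only: power2_eq_square powr_add)
      also have "\<dots> = 2 powr (real 3)" by simp
      also have "\<dots> = 2 ^ 3" by (rule powr_realpow) simp
      also have "\<dots> \<le> (3 :: real) ^ 2" by simp
      finally have "2 powr (3 / 2 :: real) \<le> 3" by (rule power2_le_imp_le) simp
      then show "2 powr (3 / 2) \<le> real k" using k by linarith
    qed (use k in auto)
    finally show ?thesis by (simp add: x_def)
  qed
  have lx: "log 2 x \<le> 2 * (x - 1)" "0 \<le> log 2 x" using x log2_le[of x] by auto
  have y: "2 \<le> y" using lx x unfolding y_def by linarith
  \<comment> \<open>The linear bound 3x + 7/2 is at most 11x/2 once x \<ge> 7/5, which the lower
    bound on x guarantees.\<close>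
  have "y \<le> x + 2 * (x - 1) + 11 / 2" using lx by (simp add: y_def)
  also have "\<dots> \<le> 11 / 2 * x" using x by (simp add: field_simps)
  finally have yx: "y \<le> 11 / 2 * x" .
  have "2 * log 2 (11 / 2 :: real) = log 2 ((11 / 2) ^ 2)" by (simp add: log_nat_power)
  also have "\<dots> \<le> log 2 (2 ^ 5)" by (subst log_le_cancel_iff) (auto simp: power2_eq_square)
  also have "\<dots> = 5" by (subst log_nat_power) auto
  finally have l11: "log 2 (11 / 2 :: real) \<le> 5 / 2" by simp
  have "log 2 y \<le> log 2 (11 / 2 * x)" using y yx by (subst log_le_cancel_iff) auto
  also have "\<dots> = log 2 (11 / 2) + log 2 x" using x by (subst log_mult) auto
  finally have ly: "log 2 y \<le> 5 / 2 + log 2 x" using l11 by simp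
  have N0: "0 < N" using y k by (simp add: N_def)
  have t: "1 < t" using nN N0 by (simp add: t_def)
  have "N * t = real n" using N0 by (simp add: t_def)
  then have nt: "4 * real k * y * t = real n" by (simp add: N_def)
  have n0: "0 < n" using r by (metis gr0I le_zero_eq power_not_zero zero_neq_numeral)
  have "real (r - 1) = log 2 (2 ^ (r - 1))" by (subst log_nat_power) auto
  also have "\<dots> \<le> log 2 (real n)"
  proof (subst log_le_cancel_iff)
    have "real (2 ^ (r - 1)) \<le> real n" using r(1) by (simp only: of_nat_le_iff)
    then show "(2 :: real) ^ (r - 1) \<le> real n" by simp
  qed (use n0 in auto)
  also have "\<dots> = log 2 (4 * real k * y * t)" by (simp add: nt)
  also have "\<dots> = 2 + x + log 2 y + log 2 t"
  proof -
    have "log 2 (4 :: real) = log 2 (2 ^ 2)" by simp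
    also have "\<dots> = 2" by (subst log_nat_power) auto
    finally show ?thesis using k y t by (simp add: log_mult x_def)
  qed
  also have "\<dots> \<le> y - 1 + 2 * (t - 1)" using ly log2_le[of t] t by (simp add: y_def)
  finally have "real r \<le> y + 2 * (t - 1)" using r(2) by (simp add: of_nat_diff)
  also have "\<dots> \<le> y * t" using mult_right_mono[of 2 y "t - 1"] y t by (simp add: algebra_simps)
  finally have ryt: "real r \<le> y * t" .
  have "real n \<le> real (4 * r * (k - 1) + 1)" using n by (simp only: of_nat_le_iff)
  also have "\<dots> = 4 * real r * (real k - 1) + 1" using k by (simp add: of_nat_diff)
  also have "\<dots> \<le> 4 * (y * t) * (real k - 1) + 1" using ryt k by (intro add_right_mono mult_right_mono) auto
  also have "\<dots> = 4 * real k * y * t - 4 * (y * t) + 1" by (simp add: algebra_simps)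
  also have "\<dots> < 4 * real k * y * t"
    using mult_mono[of 2 y 1 t] y t by simp
  also have "\<dots> = real n" by (rule nt)
  finally show False by simp
qed

text \<open>Apply the hypothesis with the least r satisfying n < 2^r; then 2^(r-1) \<le> n limits r
  to about log n. The case n = 0 is separate, as it has no such lower power of two.\<close>

lemma hitting_set_estimate:
  fixes n m k l :: nat
  assumes k: "2 \<le> k" and l: "3 \<le> l"
    and n: "\<forall>r\<ge>1. n < 2 ^ r \<longrightarrow> n \<le> 4 * r * (k - 1) + 1" and m: "2 * m \<le> 5 * n + 4 * (k - 1)"
  shows "real m \<le> f_bound l k"
proof (cases "n = 0")
  case True
  then have "m \<le> 2 * k" using m by simp
  then have "real m \<le> 40 * real k" by simp
  moreover have "1 \<le> log 2 (real k)" using k by simp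
  then have "0 \<le> 10 * real k * log 2 (real k)" "0 \<le> 10 * real k * log 2 (log 2 (real k))" by simp_all
  moreover have "0 \<le> 6 * real k * real l" by simp
  moreover have "f_bound l k = 6 * real k * real l + 10 * real k * log 2 (real k) + 40 * real k +
      10 * real k * log 2 (log 2 (real k))" using k by (simp add: f_bound_def)
  ultimately show ?thesis by linarith
next
  case False
  then obtain r' where r': "2 ^ r' \<le> n" "n < 2 ^ (r' + 1)" using ex_power_ivl1[of 2 n] by auto
  define r where "r = Suc r'"
  have r: "2 ^ (r - 1) \<le> n" "1 \<le> r" "n \<le> 4 * r * (k - 1) + 1"
    using r' n[rule_format, of r] by (auto simp: r_def)
  have "6 * real k * 3 \<le> 6 * real k * real l" using l by (intro mult_left_mono) auto
  show ?thesis
  \<comment> \<open>Here log k = 1 is below the 3/2 that \<open>branch_estimate\<close> relies on.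
    Directly, r \<le> 5 gives n \<le> 21 and m \<le> 54, while the bound is 12l + 100.\<close>
  proof (cases "k = 2")
    case True
    have "4 * s + 1 < (2 :: nat) ^ (s - 1)" if "6 \<le> s" for s
      using that
    proof (induction s rule: dec_induct)
      case (step s)
      then have "(2 :: nat) ^ s = 2 * 2 ^ (s - 1)" by (cases s) auto
      then show ?case using step by simp
    qed simp
    moreover have "2 ^ (r - 1) \<le> 4 * r + 1" using r True by simp
    ultimately have "r < 6" by (meson not_le)
    then have "n \<le> 21" using r True by simp
    then have "m \<le> 54" using m True by simp
    then show ?thesis using True l by (simp add: f_bound_def)
  next
    case k3: False
    then have "real n \<le> 4 * real k * (log 2 (real k) + log 2 (log 2 (real k)) + 11 / 2)"
      using k r by (intro branch_estimate[of k r]) auto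
    moreover have "2 * real m \<le> 5 * real n + 4 * real k" using m by linarith
    \<comment> \<open>The linear terms add up to 55k + 2k = 57k; the bound offers 40k and, because l
      \<ge> 3, another 18k from 6kl.\<close>
    ultimately have "real m \<le> 10 * real k * (log 2 (real k) + log 2 (log 2 (real k)) + 11 / 2) + 2 * real k"
      by (simp add: algebra_simps)
    also have "\<dots> \<le> f_bound l k"
      using k \<open>6 * real k * 3 \<le> 6 * real k * real l\<close> by (simp add: f_bound_def algebra_simps)
    finally show ?thesis .
  qed
qed

text \<open>The increment pays for the at most 6l vertices of a cycle deleted in the induction
  step.\<close>

lemma f_bound_Suc:
  assumes "1 \<le> k"
  shows "f_bound l k + 6 * real l \<le> f_bound l (Suc k)"
proof (cases "k = 1")
  case True
  then show ?thesis by (simp add: f_bound_def)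
next
  case False
  then have k: "2 \<le> k" using assms by simp
  define x y where "x = log 2 (real k)" and "y = log 2 (real (Suc k))"
  have x: "1 \<le> x" using k by (simp add: x_def)
  have xy: "x \<le> y" using k by (simp add: x_def y_def)
  have l: "0 \<le> log 2 x" "log 2 x \<le> log 2 y" using x xy by auto
  have "10 * real k * x \<le> 10 * real (Suc k) * y" using x xy by (intro mult_mono) auto
  moreover have "10 * real k * log 2 x \<le> 10 * real (Suc k) * log 2 y" using l by (intro mult_mono) auto
  moreover have "f_bound l k = 6 * real k * real l + 10 * real k * x + 40 * real k + 10 * real k * log 2 x"
    using k by (simp add: f_bound_def x_def)
  moreover have "f_bound l (Suc k) = 6 * real (Suc k) * real l + 10 * real (Suc k) * y +
      40 * real (Suc k) + 10 * real (Suc k) * log 2 y"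
    using k by (simp add: f_bound_def y_def)
  moreover have "6 * real (Suc k) * real l = 6 * real k * real l + 6 * real l"
    by (simp add: algebra_simps)
  ultimately show ?thesis by simp
qed

subsection \<open>Induction on the number of cycles\<close>

lemma erdos_posa_edges:
  assumes "finite F" "\<forall>e\<in>F. card e = 2" "3 \<le> l" "1 \<le> k"
  shows "packing F l k \<or> (\<exists>X\<subseteq>\<Union>F. real (card X) \<le> f_bound l k \<and>
    \<not> (\<exists>c. cyc F c \<and> l \<le> length c \<and> set c \<inter> X = {}))"
  using assms(4,1,2)
proof (induction k arbitrary: F rule: dec_induct)
  case base
  show ?case
  proof (cases "\<exists>c. cyc F c \<and> l \<le> length c")
    case True
    then obtain c where "cyc F c" "l \<le> length c" by blast
    then have "packing F l 1" unfolding packing_def by (intro exI[of _ "[c]"]) simp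
    then show ?thesis ..
  next
    case False
    then show ?thesis by (intro disjI2 exI[of _ "{}"]) (simp add: f_bound_def)
  qed
next
  case (step k)
  note fin = step.prems(1) and two = step.prems(2)
  show ?case
  proof (cases "\<exists>c. cyc F c \<and> l \<le> length c \<and> length c \<le> 6 * l")
    case True
    then obtain c where c: "cyc F c" "l \<le> length c" "length c \<le> 6 * l" by blast
    define G where "G = {e \<in> F. e \<inter> set c = {}}"
    have GF: "G \<subseteq> F" by (auto simp: G_def)
    have U: "\<Union>(cedges d) = set d" if "cyc F' d" for F' and d :: "'a list"
      by (rule Union_cedges) (use that in \<open>auto simp: cyc_def\<close>)
    have "packing G l k \<or> (\<exists>X\<subseteq>\<Union>G. real (card X) \<le> f_bound l k \<and>
      \<not> (\<exists>d. cyc G d \<and> l \<le> length d \<and> set d \<inter> X = {}))"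
      by (rule step.IH) (use fin two in \<open>auto simp: G_def\<close>)
    then show ?thesis
    proof
      assume "packing G l k"
      then obtain Cs where Cs: "length Cs = k" "\<forall>d\<in>set Cs. cyc G d \<and> l \<le> length d"
        "sorted_wrt (\<lambda>c d. set c \<inter> set d = {}) Cs" by (auto simp: packing_def)
      have "set c \<inter> set d = {}" if "d \<in> set Cs" for d
      proof -
        have d: "cyc G d" using Cs(2) that by blast
        then have "\<forall>e\<in>cedges d. e \<inter> set c = {}" by (auto simp: cyc_def G_def)
        then show ?thesis unfolding U[OF d, symmetric] by blast
      qed
      then have "packing F l (Suc k)"
        unfolding packing_def using Cs c(1,2) cyc_mono[OF _ GF] by (intro exI[of _ "c # Cs"]) simp
      then show ?thesis ..
    next
      assume "\<exists>X\<subseteq>\<Union>G. real (card X) \<le> f_bound l k \<and>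
        \<not> (\<exists>d. cyc G d \<and> l \<le> length d \<and> set d \<inter> X = {})"
      then obtain X where X: "X \<subseteq> \<Union>G" "real (card X) \<le> f_bound l k"
        "\<And>d. cyc G d \<Longrightarrow> l \<le> length d \<Longrightarrow> set d \<inter> X \<noteq> {}" by blast
      have "card (X \<union> set c) \<le> card X + 6 * l"
        using card_Un_le[of X "set c"] card_length[of c] c(3) by linarith
      then have "real (card (X \<union> set c)) \<le> real (card X) + 6 * real l" by linarith
      also have "\<dots> \<le> f_bound l (Suc k)" using X(2) f_bound_Suc[OF step.hyps(1), of l] by simp
      finally have "real (card (X \<union> set c)) \<le> f_bound l (Suc k)" .
      moreover have "set c \<subseteq> \<Union>F"
        unfolding U[OF c(1), symmetric] using c(1) by (intro Union_mono) (simp add: cyc_def)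
      then have "X \<union> set c \<subseteq> \<Union>F" using X(1) GF by blast
      moreover have "set d \<inter> (X \<union> set c) \<noteq> {}" if d: "cyc F d" "l \<le> length d" for d
      proof (cases "set d \<inter> set c = {}")
        case True
        then have "e \<inter> set c = {}" if "e \<in> cedges d" for e
          using that unfolding U[OF d(1), symmetric] by blast
        then have "cedges d \<subseteq> G" using d(1) by (auto simp: cyc_def G_def)
        then have "cyc G d" using d(1) by (simp add: cyc_def)
        then show ?thesis using X(3) d(2) by blast
      qed blast
      ultimately show ?thesis by blast
    qed
  next
    case False
    then interpret gap_graph F l
      using fin two assms(3) by unfold_locales (auto simp: not_le)
    show ?thesis
    proof (cases "packing F l (Suc k)")
      case f: False
      then obtain n X where "X \<subseteq> \<Union>F" "2 * card X \<le> 5 * n + 4 * (Suc k - 1)"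
        "\<forall>r\<ge>1. n < 2 ^ r \<longrightarrow> n \<le> 4 * r * (Suc k - 1) + 1"
        "\<not> (\<exists>c. cyc F c \<and> l \<le> length c \<and> set c \<inter> X = {})"
        using gap_hitting_set[OF f] by auto
      moreover from this have "real (card X) \<le> f_bound l (Suc k)"
        by (intro hitting_set_estimate[of "Suc k" l n]) (use step.hyps l3 in auto)
      ultimately show ?thesis by blast
    qed simp
  qed
qed

section \<open>Translation between adjacency relations and edge sets\<close>

lemma is_cycle_iff_cyc:
  assumes g: "finite_simple_graph V E"
  shows "is_cycle V E c \<longleftrightarrow> cyc {{x, y} | x y. E x y} c"
proof -
  define F where "F = {{x, y} | x y. E x y}"
  have sym: "{x, y} \<in> F \<longleftrightarrow> E x y" for x y
    using g by (auto simp: F_def finite_simple_graph_def doubleton_eq_iff)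
  have VF: "\<Union>F \<subseteq> V" using g by (auto simp: F_def finite_simple_graph_def)
  have ce: "cedges c = (\<lambda>i. {c ! i, c ! ((i + 1) mod length c)}) ` {..<length c}" if "c \<noteq> []"
  proof -
    have "cedges c = (\<lambda>i. {(c @ [hd c]) ! i, (c @ [hd c]) ! Suc i}) ` {..<length c}"
      unfolding cedges_def edges_conv_nth by (simp add: setcompr_eq_image lessThan_def)
    also have "\<dots> = (\<lambda>i. {c ! i, c ! ((i + 1) mod length c)}) ` {..<length c}"
    proof (rule image_cong)
      fix i assume i: "i \<in> {..<length c}"
      have "(c @ [hd c]) ! Suc i = c ! ((i + 1) mod length c)"
      proof (cases "Suc i < length c")
        case f: False
        then have "Suc i = length c" using i by auto
        then show ?thesis using that by (simp add: nth_append hd_conv_nth)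
      qed (simp add: nth_append)
      then show "{(c @ [hd c]) ! i, (c @ [hd c]) ! Suc i} = {c ! i, c ! ((i + 1) mod length c)}"
        using i by (simp add: nth_append)
    qed simp
    finally show ?thesis .
  qed
  have "is_cycle V E c \<longleftrightarrow> cyc F c"
  proof (cases "c = []")
    case False
    have "cedges c \<subseteq> F \<longleftrightarrow> (\<forall>i<length c. E (c ! i) (c ! ((i + 1) mod length c)))"
      unfolding ce[OF False] image_subset_iff sym by auto
    moreover have "set c \<subseteq> V" if "cedges c \<subseteq> F"
      using Union_mono[OF that] Union_cedges[OF False] VF by simp
    ultimately show ?thesis unfolding is_cycle_def cyc_def by blast
  qed (simp add: is_cycle_def cyc_def)
  then show ?thesis by (simp add: F_def)
qed

theorem theorem1:
  fixes V :: "'a set" and E :: "'a \<Rightarrow> 'a \<Rightarrow> bool" and l k :: nat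
  assumes "l \<ge> 3" and "k \<ge> 1" and "finite_simple_graph V E"
  shows "(\<exists>Cs :: 'a list list. length Cs = k
            \<and> (\<forall>c \<in> set Cs. is_cycle V E c \<and> length c \<ge> l)
            \<and> (\<forall>i < k. \<forall>j < k. i \<noteq> j \<longrightarrow> set (Cs ! i) \<inter> set (Cs ! j) = {}))
       \<or> (\<exists>X \<subseteq> V. real (card X) \<le> f_bound l k
            \<and> \<not> (\<exists>c. is_cycle (del_verts_V V X) (del_verts_E E X) c \<and> length c \<ge> l))"
proof -
  define F where "F = {{x, y} | x y. E x y}"
  have FV: "F \<subseteq> Pow V" using assms(3) by (auto simp: F_def finite_simple_graph_def)
  have fin: "finite F"
    by (rule finite_subset[OF FV]) (use assms(3) in \<open>simp add: finite_simple_graph_def\<close>)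
  have two: "\<forall>e\<in>F. card e = 2"
    using assms(3) by (auto simp: F_def finite_simple_graph_def card_insert_if)
  have cyc: "is_cycle V E c \<longleftrightarrow> cyc F c" for c
    unfolding F_def by (rule is_cycle_iff_cyc[OF assms(3)])
  from erdos_posa_edges[OF fin two assms(1,2)] show ?thesis
  proof
    assume "packing F l k"
    then obtain Cs where Cs: "length Cs = k" "\<forall>c\<in>set Cs. cyc F c \<and> l \<le> length c"
      "sorted_wrt (\<lambda>c d. set c \<inter> set d = {}) Cs" by (auto simp: packing_def)
    have "set (Cs ! i) \<inter> set (Cs ! j) = {}" if "i < k" "j < k" "i \<noteq> j" for i j
    proof (cases "i < j")
      case True
      then show ?thesis using Cs(1,3) that by (simp add: sorted_wrt_iff_nth_less)
    next
      case False
      then have "set (Cs ! j) \<inter> set (Cs ! i) = {}"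
        using Cs(1,3) that by (simp add: sorted_wrt_iff_nth_less)
      then show ?thesis by blast
    qed
    then show ?thesis using Cs cyc by (intro disjI1 exI[of _ Cs]) simp
  next
    assume "\<exists>X\<subseteq>\<Union>F. real (card X) \<le> f_bound l k \<and>
      \<not> (\<exists>c. cyc F c \<and> l \<le> length c \<and> set c \<inter> X = {})"
    then obtain X where X: "X \<subseteq> \<Union>F" "real (card X) \<le> f_bound l k"
      "\<not> (\<exists>c. cyc F c \<and> l \<le> length c \<and> set c \<inter> X = {})" by blast
    have "cyc F c \<and> set c \<inter> X = {}" if "is_cycle (del_verts_V V X) (del_verts_E E X) c" for c
    proof -
      have "is_cycle V E c" "set c \<inter> X = {}"
        using that by (auto simp: is_cycle_def del_verts_V_def del_verts_E_def)
      then show ?thesis using cyc by simp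
    qed
    then have "\<not> (\<exists>c. is_cycle (del_verts_V V X) (del_verts_E E X) c \<and> l \<le> length c)"
      using X(3) by blast
    moreover have "X \<subseteq> V" using X(1) FV by blast
    ultimately show ?thesis using X(2) by (intro disjI2 exI[of _ X]) simp
  qed
qed

end
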